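(* Let $\alpha\in(0,1/2]$ and consider the model D-EX-t$(\zeta_n)$ described in the context with $\lim_{n\to\infty}\zeta_n=1$; write $\operatorname{FDR}_\infty(1)=\operatorname{FDR}_\infty(1;\nu)$ for its dependence on the degrees of freedom $\nu$. Then \[ \lim_{\nu\to\infty}\operatorname{FDR}_\infty(1;\nu)=\Phi\big(-\sqrt{-2\ln(\alpha)}\big). \]
   Context: Model D-EX-t$(\zeta_n)$ with $\nu$ degrees of freedom: $X_1,\dots,X_n$ independent with $X_i\sim N(\vartheta_i,1)$, $S>0$ with $\nu S^2\sim\chi^2_\nu$ independent of the $X_i$; $\Phi$ is the standard normal c.d.f. and $F_{t_\nu}$ the central $t_\nu$ c.d.f. For $H_i:\vartheta_i=0$ vs $K_i:\vartheta_i>0$, $T_i=X_i/S$ and $p_i=1-F_{t_\nu}(T_i)$; $\vartheta_i=\infty$ is allowed and gives $p_i=0$ a.s. For each $n$, exactly $n_0$ hypotheses are true ($\vartheta_i=0$), $\zeta_n=n_0/n$, and the rest have $\vartheta_i=\infty$. The linear step-up procedure at level $\alpha$ rejects all $H_i$ with $p_i\le m\alpha/n$, $m=\max\{i:p_{i:n}\le i\alpha/n\}$ (ordered $p$-values $p_{1:n}\le\dots\le p_{n:n}$). $V_n$ = number of rejected true hypotheses, $R_n$ = number of rejections, and $\operatorname{FDR}_\infty(1)=\lim_{n\to\infty}\mathbb E[V_n/(R_n\vee1)]$. *)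

theory Defs
  imports "HOL-Probability.Probability"
begin

definition std_normal :: "real measure" where
  "std_normal = density lborel std_normal_density"

definition Phi :: "real \<Rightarrow> real" where
  "Phi x = cdf std_normal x"

definition t_density :: "nat \<Rightarrow> real \<Rightarrow> real" where
  "t_density \<nu> x = Gamma ((real \<nu> + 1) / 2) / (sqrt (real \<nu> * pi) * Gamma (real \<nu> / 2))
      * (1 + x\<^sup>2 / real \<nu>) powr (- (real \<nu> + 1) / 2)"

definition F_t :: "nat \<Rightarrow> real \<Rightarrow> real" where
  "F_t \<nu> x = cdf (density lborel (t_density \<nu>)) x"

text \<open>Underlying probability space for n0 true nulls and nu degrees of freedom:
  the first component holds X_1..X_n0 (i.i.d. N(0,1)), the second component holds
  Z_1..Z_nu i.i.d. N(0,1), independent of the X's; S = sqrt((Z_1^2+...+Z_nu^2)/nu),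
  so that nu S^2 ~ chi^2_nu.\<close>
definition DEXt_space :: "nat \<Rightarrow> nat \<Rightarrow> ((nat \<Rightarrow> real) \<times> (nat \<Rightarrow> real)) measure" where
  "DEXt_space n0 \<nu> = (PiM {..<n0} (\<lambda>_. std_normal)) \<Otimes>\<^sub>M (PiM {..<\<nu>} (\<lambda>_. std_normal))"

definition S_stat :: "nat \<Rightarrow> (nat \<Rightarrow> real) \<Rightarrow> real" where
  "S_stat \<nu> z = sqrt ((\<Sum>j<\<nu>. (z j)\<^sup>2) / real \<nu>)"

text \<open>p-values: true nulls i < n0 get p_i = 1 - F_t(X_i/S); false nulls
  (theta_i = infinity, i.e. n0 \<le> i < n) get p_i = 0.\<close>
definition pvals :: "nat \<Rightarrow> nat \<Rightarrow> (nat \<Rightarrow> real) \<times> (nat \<Rightarrow> real) \<Rightarrow> nat \<Rightarrow> real" where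
  "pvals n0 \<nu> \<omega> i = (if i < n0 then 1 - F_t \<nu> (fst \<omega> i / S_stat \<nu> (snd \<omega>)) else 0)"

definition LSU_m :: "real \<Rightarrow> nat \<Rightarrow> (nat \<Rightarrow> real) \<Rightarrow> nat" where
  "LSU_m \<alpha> n p = Max ({0} \<union> {i \<in> {1..n}. sort (map p [0..<n]) ! (i - 1) \<le> real i * \<alpha> / real n})"

definition LSU_rejected :: "real \<Rightarrow> nat \<Rightarrow> (nat \<Rightarrow> real) \<Rightarrow> nat set" where
  "LSU_rejected \<alpha> n p = {i \<in> {..<n}. p i \<le> real (LSU_m \<alpha> n p) * \<alpha> / real n}"

definition FDR_DEXt :: "real \<Rightarrow> nat \<Rightarrow> nat \<Rightarrow> nat \<Rightarrow> real" where
  "FDR_DEXt \<alpha> n n0 \<nu> = (\<integral>\<omega>. (let p = pvals n0 \<nu> \<omega>;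
        V = card (LSU_rejected \<alpha> n p \<inter> {..<n0});
        R = card (LSU_rejected \<alpha> n p)
      in real V / real (max R 1)) \<partial>DEXt_space n0 \<nu>)"

end

(*
Condition on S = s.  A true null then has p-value at most G(c), where G = 1 - F_t, with probability
Phi(-s c), and as n grows the empirical distribution of the null p-values settles at this curve.

If alpha Phi(-s c) > G(c) for some c, the step-up line is crossed at a positive level: a positive
fraction of the hypotheses is rejected, almost all of them true, and the conditional FDR tends to 1.
If alpha Phi(-s c) < G(c) for all c, Hoeffding's inequality excludes more than delta n rejections for
every delta > 0.  Below that, a rejected hypothesis has 1/R <= alpha / (n p_i), so the expected false
discovery proportion is at most alpha E[1/p; p <= delta alpha | s].  This vanishes with delta because
1/p is integrable given S = s: the t-tail is polynomial and the normal tail is Gaussian.  At most one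
s > 0 belongs to neither case, and S has no atoms.  Hence the limit is the probability that S lies in
the crossing set, which is an initial segment of the positive reals.

For nu -> infinity write the scale as s^2 = 1 - b sqrt(2/nu).  The maximum over c of the quotient of
the densities of alpha Phi(-s c) and G(c) tends to alpha exp(b^2/2), so s lies in the crossing set eventually if
b > sqrt(-2 ln alpha), and eventually not if b < sqrt(-2 ln alpha).  By the central limit theorem for
the chi-square distribution, P(S <= s) tends to Phi(-b).
*)
theory Submission
  imports Defs "HOL-Real_Asymp.Real_Asymp"
begin

section \<open>The linear step-up procedure\<close>

text \<open>The crossing point escapes to infinity, and this shapes the last half of the proof. At
  s^2 = 1 - b sqrt(2/\<nu>) the logarithm of the density quotient is, up to constants, (\<nu> + 1)/2
  ln(1 + u^2/\<nu>) - s^2 u^2/2. It peaks where 1 + u^2/\<nu> = w with w - 1 about b sqrt(2/\<nu>),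
  hence at u of order \<nu>^(1/4), and its value there is about \<nu> (w - 1)^2/4 = b^2/2.
  Convergence of the t-distribution to the normal one at fixed arguments therefore decides nothing.
  Absence of a crossing follows by integrating a comparison of densities from infinity; its presence
  needs tail bounds whose relative error vanishes at the peak.

  The critical scale at finite \<nu> is never computed: only its uniqueness and the initial-segment
  property are used. Both rest on \<alpha> \<le> 1/2, which forces crossings to lie at c > 0, where
  Phi(-s c) decreases in s.

  The case without crossing needs the 1/p bound because the gap between the two curves closes as the
  threshold tends to 0, so concentration alone controls only rejection counts proportional to
  n.\<close>

definition FDP :: "real \<Rightarrow> nat \<Rightarrow> nat \<Rightarrow> (nat \<Rightarrow> real) \<Rightarrow> real" where
  "FDP \<alpha> n n0 p = real (card (LSU_rejected \<alpha> n p \<inter> {..<n0})) / real (max (card (LSU_rejected \<alpha> n p)) 1)"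

lemma sorted_nth_le_iff:
  assumes "sorted xs" "0 < k" "k \<le> length xs"
  shows "xs ! (k - 1) \<le> t \<longleftrightarrow> k \<le> length (filter (\<lambda>x. x \<le> t) xs)"
  using assms
proof (induction xs arbitrary: k)
  case Nil
  then show ?case by simp
next
  case (Cons x xs)
  show ?case
  proof (cases "x \<le> t")
    case True
    show ?thesis
    proof (cases "k = 1")
      case True
      then show ?thesis using \<open>x \<le> t\<close> by simp
    next
      case False
      then obtain j where j: "k = Suc j" "0 < j" using Cons.prems by (cases k) auto
      have "xs ! (j - 1) \<le> t \<longleftrightarrow> j \<le> length (filter (\<lambda>x. x \<le> t) xs)"
        using Cons j by auto
      then show ?thesis using j True by (cases j) auto
    qed
  next
    case False
    then have gt: "\<And>y. y \<in> set (x # xs) \<Longrightarrow> \<not> y \<le> t" using Cons.prems by auto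
    then have "filter (\<lambda>x. x \<le> t) (x # xs) = []" unfolding filter_empty_conv by blast
    moreover have "(x # xs) ! (k - 1) \<in> set (x # xs)" using Cons.prems by (intro nth_mem) auto
    ultimately show ?thesis using gt Cons.prems by (metis list.size(3) not_less)
  qed
qed

text \<open>Order statistics are traded for counts: counts are sums of indicators, which suit both
  measurability and Hoeffding's inequality.\<close>

lemma sort_nth_le_iff_card:
  fixes p :: "nat \<Rightarrow> real"
  assumes "0 < k" "k \<le> n"
  shows "sort (map p [0..<n]) ! (k - 1) \<le> t \<longleftrightarrow> k \<le> card {i\<in>{..<n}. p i \<le> t}"
proof -
  have "length (filter (\<lambda>x. x \<le> t) (sort (map p [0..<n]))) = length (filter (\<lambda>x. x \<le> t) (map p [0..<n]))"
    by (metis filter_sort length_sort)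
  also have "\<dots> = length (filter (\<lambda>i. p i \<le> t) [0..<n])"
    by (simp add: filter_map comp_def)
  also have "\<dots> = card (set (filter (\<lambda>i. p i \<le> t) [0..<n]))"
    by (rule distinct_card[symmetric]) simp
  also have "set (filter (\<lambda>i. p i \<le> t) [0..<n]) = {i\<in>{..<n}. p i \<le> t}" by auto
  finally show ?thesis using sorted_nth_le_iff[of "sort (map p [0..<n])" k t] assms by simp
qed

lemma LSU_m_altdef:
  "LSU_m \<alpha> n p = Max ({0} \<union> {k \<in> {1..n}. k \<le> card {i\<in>{..<n}. p i \<le> real k * \<alpha> / real n}})"
proof -
  have "{k \<in> {1..n}. sort (map p [0..<n]) ! (k - 1) \<le> real k * \<alpha> / real n}
      = {k \<in> {1..n}. k \<le> card {i\<in>{..<n}. p i \<le> real k * \<alpha> / real n}}"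
    by (rule Collect_cong) (use sort_nth_le_iff_card in auto)
  then show ?thesis unfolding LSU_m_def by simp
qed

lemma LSU_m_ge:
  assumes "0 < k" "k \<le> n" "k \<le> card {i\<in>{..<n}. p i \<le> real k * \<alpha> / real n}"
  shows "k \<le> LSU_m \<alpha> n p"
  unfolding LSU_m_altdef by (rule Max_ge) (use assms in auto)

lemma LSU_m_le: "LSU_m \<alpha> n p \<le> n"
  unfolding LSU_m_altdef by (subst Max_le_iff) auto

lemma LSU_m_card:
  "LSU_m \<alpha> n p \<le> card {i\<in>{..<n}. p i \<le> real (LSU_m \<alpha> n p) * \<alpha> / real n}"
proof -
  let ?S = "{0} \<union> {k \<in> {1..n}. k \<le> card {i\<in>{..<n}. p i \<le> real k * \<alpha> / real n}}"
  have "Max ?S \<in> ?S" by (rule Max_in) auto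
  then show ?thesis unfolding LSU_m_altdef[symmetric] by auto
qed

text \<open>If more than m p-values lay below the line at the step-up index m, their number r would
  itself satisfy the step-up condition, since the line at r is higher; this contradicts the
  maximality of m. Hence R may be replaced by the step-up index throughout.\<close>

lemma card_LSU_rejected:
  assumes "0 < \<alpha>"
  shows "card (LSU_rejected \<alpha> n p) = LSU_m \<alpha> n p"
proof (rule antisym)
  let ?m = "LSU_m \<alpha> n p" and ?r = "card (LSU_rejected \<alpha> n p)"
  show "?m \<le> ?r" using LSU_m_card unfolding LSU_rejected_def .
  show "?r \<le> ?m"
  proof (rule ccontr)
    assume lt: "\<not> ?r \<le> ?m"
    have rn: "?r \<le> n" unfolding LSU_rejected_def
      by (metis (no_types, lifting) card_lessThan card_mono finite_lessThan mem_Collect_eq subsetI)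
    have "LSU_rejected \<alpha> n p \<subseteq> {i\<in>{..<n}. p i \<le> real ?r * \<alpha> / real n}"
    proof
      fix i assume "i \<in> LSU_rejected \<alpha> n p"
      then have i: "i < n" "p i \<le> real ?m * \<alpha> / real n" by (auto simp: LSU_rejected_def)
      have "real ?m * \<alpha> / real n \<le> real ?r * \<alpha> / real n"
        using lt assms by (intro divide_right_mono mult_right_mono) auto
      with i show "i \<in> {i\<in>{..<n}. p i \<le> real ?r * \<alpha> / real n}" by auto
    qed
    then have "?r \<le> card {i\<in>{..<n}. p i \<le> real ?r * \<alpha> / real n}" by (intro card_mono) auto
    then have "?r \<le> ?m" using rn lt by (intro LSU_m_ge) auto
    with lt show False by simp
  qed
qed

lemma FDP_bounds: "0 \<le> FDP \<alpha> n n0 p" "FDP \<alpha> n n0 p \<le> 1"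
proof -
  have fin: "finite (LSU_rejected \<alpha> n p)" by (simp add: LSU_rejected_def)
  show "0 \<le> FDP \<alpha> n n0 p" by (simp add: FDP_def)
  have "card (LSU_rejected \<alpha> n p \<inter> {..<n0}) \<le> card (LSU_rejected \<alpha> n p)"
    by (intro card_mono fin) auto
  then show "FDP \<alpha> n n0 p \<le> 1" by (simp add: FDP_def)
qed

lemma FDP_altdef:
  assumes "0 < \<alpha>" "n0 \<le> n"
  shows "FDP \<alpha> n n0 p =
    real (card {i\<in>{..<n0}. p i \<le> real (LSU_m \<alpha> n p) * \<alpha> / real n}) / real (max (LSU_m \<alpha> n p) 1)"
proof -
  have "LSU_rejected \<alpha> n p \<inter> {..<n0} = {i\<in>{..<n0}. p i \<le> real (LSU_m \<alpha> n p) * \<alpha> / real n}"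
    using assms by (auto simp: LSU_rejected_def)
  then show ?thesis by (simp add: FDP_def card_LSU_rejected[OF assms(1)])
qed

section \<open>Measurability of the step-up index and of the false discovery proportion\<close>

lemma real_card_eq_sum_of_bool:
  "finite I \<Longrightarrow> real (card {i\<in>I. P i}) = (\<Sum>i\<in>I. of_bool (P i))"
  by (simp add: sum.inter_filter[symmetric] of_bool_def)

text \<open>Finitely many counting conditions describe each level set of the step-up index, so its
  measurability reduces to that of counts.\<close>

lemma LSU_m_eq_iff:
  "LSU_m \<alpha> n p = k \<longleftrightarrow> k \<le> n \<and> k \<le> card {i\<in>{..<n}. p i \<le> real k * \<alpha> / real n}
     \<and> (\<forall>j\<in>{k<..n}. \<not> j \<le> card {i\<in>{..<n}. p i \<le> real j * \<alpha> / real n})" (is "_ \<longleftrightarrow> ?R")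
proof
  assume m: "LSU_m \<alpha> n p = k"
  have "\<not> j \<le> card {i\<in>{..<n}. p i \<le> real j * \<alpha> / real n}" if "j \<in> {k<..n}" for j
    using LSU_m_ge[of j n p \<alpha>] m that by auto
  then show ?R
    using LSU_m_le[of \<alpha> n p] LSU_m_card[of \<alpha> n p] m by simp
next
  assume R: ?R
  have "k \<le> LSU_m \<alpha> n p" using R LSU_m_ge[of k n p \<alpha>] by (cases "k = 0") auto
  moreover have "\<not> k < LSU_m \<alpha> n p"
    using R LSU_m_le[of \<alpha> n p] LSU_m_card[of \<alpha> n p] by (metis greaterThanAtMost_iff)
  ultimately show "LSU_m \<alpha> n p = k" by simp
qed

lemma measurable_LSU_m:
  assumes [measurable]: "\<And>i. i < n \<Longrightarrow> (\<lambda>\<omega>. p \<omega> i) \<in> borel_measurable M"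
  shows "(\<lambda>\<omega>. LSU_m \<alpha> n (p \<omega>)) \<in> measurable M (count_space UNIV)"
proof -
  have [measurable]: "Measurable.pred M (\<lambda>\<omega>. k \<le> card {i\<in>{..<n}. p \<omega> i \<le> t})" for k t
  proof -
    have "(\<lambda>\<omega>. k \<le> card {i\<in>{..<n}. p \<omega> i \<le> t}) = (\<lambda>\<omega>. real k \<le> (\<Sum>i<n. of_bool (p \<omega> i \<le> t)))"
      by (simp only: real_card_eq_sum_of_bool[OF finite_lessThan, symmetric] of_nat_le_iff)
    moreover have "Measurable.pred M (\<lambda>\<omega>. real k \<le> (\<Sum>i<n. of_bool (p \<omega> i \<le> t)))"
      unfolding of_bool_def by measurable
    ultimately show ?thesis by simp
  qed
  show ?thesis
  proof (subst measurable_count_space_eq2_countable, intro conjI ballI)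
    fix k
    have "(\<lambda>\<omega>. LSU_m \<alpha> n (p \<omega>)) -` {k} \<inter> space M = {\<omega>\<in>space M. LSU_m \<alpha> n (p \<omega>) = k}" by auto
    also have "\<dots> \<in> sets M" unfolding LSU_m_eq_iff by measurable
    finally show "(\<lambda>\<omega>. LSU_m \<alpha> n (p \<omega>)) -` {k} \<inter> space M \<in> sets M" .
  qed auto
qed

lemma measurable_FDP:
  assumes "0 < \<alpha>" "n0 \<le> n" and [measurable]: "\<And>i. i < n \<Longrightarrow> (\<lambda>\<omega>. p \<omega> i) \<in> borel_measurable M"
  shows "(\<lambda>\<omega>. FDP \<alpha> n n0 (p \<omega>)) \<in> borel_measurable M"
proof -
  note [measurable] = measurable_LSU_m[OF assms(3)]
  have [measurable]: "i < n0 \<Longrightarrow> (\<lambda>\<omega>. p \<omega> i) \<in> borel_measurable M" for i using assms(2,3) by simp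
  show ?thesis
    unfolding FDP_altdef[OF assms(1,2)] real_card_eq_sum_of_bool[OF finite_lessThan] of_bool_def
    by measurable
qed

section \<open>Even densities and the normal distribution\<close>

text \<open>Common ground of the standard normal and the t-density: a differentiable, strictly
  increasing and symmetric distribution function without atoms.\<close>

locale even_density =
  fixes f :: "real \<Rightarrow> real"
  assumes continuous: "continuous_on UNIV f"
    and pos: "\<And>x. 0 < f x"
    and even: "\<And>x. f (- x) = f x"
    and total: "(\<integral>\<^sup>+x. ennreal (f x) \<partial>lborel) = 1"
begin

abbreviation D :: "real measure" where "D \<equiv> density lborel f"

lemma f_borel [measurable]: "f \<in> borel_measurable borel"
  using continuous by (rule borel_measurable_continuous_onI)

lemma nonneg: "0 \<le> f x" using pos[of x] by simp

sublocale prob_space D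
  by (rule prob_spaceI) (use total in \<open>simp add: emeasure_density\<close>)

sublocale real_distribution D
  by unfold_locales simp_all

lemma measure_Ioc:
  assumes "u \<le> v"
  shows "measure D {u<..v} = integral {u..v} f"
proof -
  have int: "(f has_integral integral {u..v} f) {u..v}"
    by (intro integrable_integral integrable_continuous_real continuous_on_subset[OF continuous]) auto
  have "emeasure D {u<..v} = (\<integral>\<^sup>+x. ennreal (f x) * indicator {u<..v} x \<partial>lborel)"
    by (simp add: emeasure_density)
  also have "\<dots> = (\<integral>\<^sup>+x. ennreal (indicator {u..v} x * f x) \<partial>lborel)"
    by (rule nn_integral_cong_AE, rule AE_mp[OF AE_lborel_singleton[of u]])
       (auto simp: indicator_def split: if_splits)
  also have "\<dots> = ennreal (integral {u..v} f)"
    by (rule nn_integral_has_integral_lebesgue[OF nonneg int])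
  finally show ?thesis
    using integral_nonneg[of f "{u..v}"] int nonneg by (simp add: measure_def has_integral_integrable)
qed

lemma cdf_eq_integral: "u \<le> v \<Longrightarrow> cdf D v = cdf D u + integral {u..v} f"
  using measure_Ioc[of u v] cdf_diff_eq[of u v] by (cases "u = v") auto

lemma DERIV_cdf: "(cdf D has_real_derivative f x) (at x)"
proof -
  \<comment> \<open>The base point \<open>x - 1\<close> lies strictly to the left, so the integral
    represents the distribution function on a two-sided neighbourhood of \<open>x\<close>.\<close>
  have "((\<lambda>y. cdf D (x - 1) + integral {x - 1..y} f) has_real_derivative 0 + f x) (at x within {x - 1..x + 1})"
    by (intro DERIV_add integral_has_real_derivative DERIV_const continuous_on_subset[OF continuous]) auto
  then have "(cdf D has_real_derivative f x) (at x within {x - 1..x + 1})"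
    by (simp, elim has_field_derivative_transform_within[OF _ zero_less_one])
       (auto simp: cdf_eq_integral[symmetric])
  then show ?thesis using at_within_interior[of x "{x - 1..x + 1}"] by (auto simp: interior_atLeastAtMost_real)
qed

lemma isCont_cdf_density: "isCont (cdf D) x"
  using DERIV_cdf DERIV_isCont by blast

lemma cdf_strict_mono: "x < y \<Longrightarrow> cdf D x < cdf D y"
  by (rule DERIV_pos_imp_increasing) (use DERIV_cdf pos in blast)+

lemma cdf_less_iff: "cdf D x < cdf D y \<longleftrightarrow> x < y"
  using cdf_strict_mono by (metis linorder_less_linear order_less_asym)

text \<open>By evenness of the density, F(x) + F(-x) has derivative 0; the constant is read off from
  the limit at infinity, which is 1.\<close>

lemma cdf_minus: "cdf D (- x) = 1 - cdf D x"
proof -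
  have "((\<lambda>x. cdf D x + cdf D (- x)) has_real_derivative 0) (at x)" for x
  proof -
    have "((\<lambda>x. cdf D (- x)) has_real_derivative f (- x) * (- 1)) (at x)"
      by (rule DERIV_chain2[OF DERIV_cdf]) (auto intro!: derivative_eq_intros)
    from DERIV_add[OF DERIV_cdf[of x] this] show ?thesis by (simp add: even)
  qed
  then have const: "cdf D x + cdf D (- x) = cdf D y + cdf D (- y)" for x y
    using DERIV_isconst_all[of "\<lambda>x. cdf D x + cdf D (- x)"] by blast
  have "((\<lambda>x. cdf D x + cdf D (- x)) \<longlongrightarrow> 1 + 0) at_top"
    by (intro tendsto_add cdf_lim_at_top_prob filterlim_compose[OF cdf_lim_at_bot] filterlim_uminus_at_bot_at_top)
  then have "((\<lambda>y. cdf D x + cdf D (- x)) \<longlongrightarrow> 1) (at_top :: real filter)"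
    by (subst (asm) const[of _ x]) simp
  then show ?thesis by (simp add: tendsto_const_iff)
qed

lemma cdf_0: "cdf D 0 = 1/2"
  using cdf_minus[of 0] by simp

lemma cdf_less_1: "cdf D x < 1"
  using cdf_strict_mono[of x "x + 1"] cdf_bounded_prob[of "x + 1"] by linarith

lemma emeasure_singleton: "emeasure D {x} = 0"
  by (simp add: emeasure_density nn_integral_indicator_singleton)

lemma measure_singleton: "measure D {x} = 0"
  by (simp add: measure_def emeasure_singleton)

lemma measure_atLeast: "measure D {x..} = cdf D (- x)"
proof -
  have "{x..} = {x<..} \<union> {x}" by auto
  then have "measure D {x..} = measure D {x<..}"
    by (simp only:) (subst finite_measure_Union, auto simp: measure_singleton)
  also have "{x<..} = space D - {..x}" by auto
  then have "measure D {x<..} = 1 - cdf D x" by (simp only: cdf_def2) (subst prob_compl, auto)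
  finally show ?thesis by (simp add: cdf_minus)
qed

lemma tail_at_top: "((\<lambda>x. 1 - cdf D x) \<longlongrightarrow> 0) at_top"
  using tendsto_diff[OF tendsto_const[of 1] cdf_lim_at_top_prob] by simp

end

section \<open>The standard normal distribution and its tail\<close>

lemma even_density_std_normal: "even_density std_normal_density"
proof
  show "continuous_on UNIV std_normal_density"
    unfolding std_normal_density_def by (intro continuous_intros) auto
  show "0 < std_normal_density x" for x by (simp add: normal_density_pos)
  show "std_normal_density (- x) = std_normal_density x" for x by (simp add: std_normal_density_def)
  have "(\<integral>\<^sup>+x. ennreal (std_normal_density x) \<partial>lborel) = ennreal 1"
    by (subst nn_integral_eq_integral) auto
  then show "(\<integral>\<^sup>+x. ennreal (std_normal_density x) \<partial>lborel) = 1" by simp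
qed

interpretation std: even_density std_normal_density
  by (rule even_density_std_normal)

lemma Phi_eq: "Phi = cdf (density lborel std_normal_density)"
  by (rule ext) (simp add: Phi_def std_normal_def)

lemmas DERIV_Phi = std.DERIV_cdf[folded Phi_eq]
  and isCont_Phi = std.isCont_cdf_density[folded Phi_eq]
  and Phi_strict_mono = std.cdf_strict_mono[folded Phi_eq]
  and Phi_minus = std.cdf_minus[folded Phi_eq]
  and Phi_less_1 = std.cdf_less_1[folded Phi_eq]
  and measure_std_normal_atLeast = std.measure_atLeast[folded Phi_eq std_normal_def]
  and Phi_at_top = std.cdf_lim_at_top_prob[folded Phi_eq]

lemma prob_space_std_normal [simp]: "prob_space std_normal"
  unfolding std_normal_def by (rule std.prob_space_axioms)

lemma space_std_normal [simp]: "space std_normal = UNIV"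
  and sets_std_normal [simp, measurable_cong]: "sets std_normal = sets borel"
  by (simp_all add: std_normal_def)

text \<open>The device behind the tail comparisons below: the difference of two tails vanishes at
  infinity, so an inequality between their derivatives, that is between densities, beyond
  \<open>c\<close> suffices.\<close>

lemma nonneg_of_DERIV_le_0_tendsto_0:
  fixes g :: "real \<Rightarrow> real"
  assumes "\<And>x. c \<le> x \<Longrightarrow> \<exists>y. (g has_real_derivative y) (at x) \<and> y \<le> 0"
    and "(g \<longlongrightarrow> 0) at_top"
  shows "0 \<le> g c"
proof (rule tendsto_upperbound[OF assms(2) _ trivial_limit_at_top_linorder])
  have "g x \<le> g c" if "c \<le> x" for x
    by (rule DERIV_nonpos_imp_nonincreasing[OF that]) (use assms(1) in auto)
  then show "\<forall>\<^sub>F x in at_top. g x \<le> g c" by (rule eventually_mono[OF eventually_ge_at_top])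
qed

lemma std_normal_density_at_top: "(std_normal_density \<longlongrightarrow> 0) at_top"
  unfolding std_normal_density_def by real_asymp

text \<open>The two terms begin the asymptotic expansion of the normal tail. Their derivative is
  minus the density plus 3 phi(y)/y^4, and the sign of this remainder gives the inequality. The
  relative error 1/x^2 becomes negligible at the crossing point.\<close>

lemma Mills_lower_bound:
  assumes "0 < x"
  shows "std_normal_density x * (1 / x - 1 / x ^ 3) \<le> Phi (- x)"
proof -
  let ?g = "\<lambda>x. (1 - Phi x) - std_normal_density x * (1 / x - 1 / x ^ 3)"
  have "0 \<le> ?g x"
  proof (rule nonneg_of_DERIV_le_0_tendsto_0[where g = ?g])
    fix y assume "x \<le> y"
    then have y: "0 < y" using assms by simp
    have d: "(std_normal_density has_real_derivative (- y * std_normal_density y)) (at y)"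
      unfolding std_normal_density_def by (auto intro!: derivative_eq_intros simp: field_simps)
    have r: "((\<lambda>x. 1 / x - 1 / x ^ 3) has_real_derivative (- 1 / y\<^sup>2 + 3 / y ^ 4)) (at y)"
      using y by (auto intro!: derivative_eq_intros simp: field_simps power2_eq_square power4_eq_xxxx power3_eq_cube)
    have "(?g has_real_derivative (0 - std_normal_density y) - (std_normal_density y * (- 1 / y\<^sup>2 + 3 / y ^ 4)
        + - y * std_normal_density y * (1 / y - 1 / y ^ 3))) (at y)"
      by (rule DERIV_diff[OF DERIV_diff[OF DERIV_const DERIV_Phi] DERIV_mult'[OF d r]])
    moreover have "(0 - std_normal_density y) - (std_normal_density y * (- 1 / y\<^sup>2 + 3 / y ^ 4)
        + - y * std_normal_density y * (1 / y - 1 / y ^ 3)) = - (3 * std_normal_density y / y ^ 4)"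
      using y by (simp add: field_simps power2_eq_square power4_eq_xxxx power3_eq_cube)
    ultimately show "\<exists>z. (?g has_real_derivative z) (at y) \<and> z \<le> 0" using y by fastforce
  next
    have "((\<lambda>x. 1 / x - 1 / x ^ 3) \<longlongrightarrow> (0::real)) at_top" by real_asymp
    from tendsto_mult[OF std_normal_density_at_top this]
    show "(?g \<longlongrightarrow> 0) at_top" using tendsto_diff[OF std.tail_at_top[folded Phi_eq]] by fastforce
  qed
  then show ?thesis by (simp add: Phi_minus)
qed

section \<open>The t-distribution\<close>

lemma nn_integral_gaussian:
  assumes "0 < (b::real)"
  shows "(\<integral>\<^sup>+x. ennreal (exp (- (b * x\<^sup>2))) \<partial>lborel) = ennreal (sqrt (pi / b))"
proof -
  define \<sigma> where "\<sigma> = sqrt (1 / (2 * b))"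
  have \<sigma>: "0 < \<sigma>" "\<sigma>\<^sup>2 = 1 / (2 * b)" using assms by (auto simp: \<sigma>_def)
  have "exp (- (b * x\<^sup>2)) = sqrt (pi / b) * normal_density 0 \<sigma> x" for x
    using assms by (simp add: normal_density_def \<sigma>(2) field_simps)
  then have "(\<integral>\<^sup>+x. ennreal (exp (- (b * x\<^sup>2))) \<partial>lborel)
      = ennreal (sqrt (pi / b)) * (\<integral>\<^sup>+x. ennreal (normal_density 0 \<sigma> x) \<partial>lborel)"
    using assms by (simp add: ennreal_mult' nn_integral_cmult)
  also have "(\<integral>\<^sup>+x. ennreal (normal_density 0 \<sigma> x) \<partial>lborel) = 1"
    using \<sigma> by (subst nn_integral_eq_integral) auto
  finally show ?thesis by simp
qed

lemma nn_integral_Gamma_scaled: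
  assumes "0 < (s::real)" "0 < q"
  shows "(\<integral>\<^sup>+y. ennreal (indicator {0<..} y * y powr (s - 1) * exp (- (q * y))) \<partial>lborel)
    = ennreal (Gamma s * q powr (- s))"
proof -
  have "ennreal (Gamma s) = (\<integral>\<^sup>+t. ennreal (indicator {0..} t * t powr (s - 1) / exp t) \<partial>lborel)"
    by (rule Gamma_conv_nn_integral_real[OF assms(1)])
  also have "\<dots> = \<bar>q\<bar> * (\<integral>\<^sup>+t. ennreal (indicator {0..} (0 + q * t) * (0 + q * t) powr (s - 1) / exp (0 + q * t)) \<partial>lborel)"
    by (rule nn_integral_real_affine) (use assms in auto)
  also have "(\<integral>\<^sup>+t. ennreal (indicator {0..} (0 + q * t) * (0 + q * t) powr (s - 1) / exp (0 + q * t)) \<partial>lborel)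
      = (\<integral>\<^sup>+t. ennreal (q powr (s - 1)) * ennreal (indicator {0<..} t * t powr (s - 1) * exp (- (q * t))) \<partial>lborel)"
    by (rule nn_integral_cong_AE, rule AE_mp[OF AE_lborel_singleton[of 0]])
       (use assms in \<open>auto simp: indicator_def powr_mult exp_minus field_simps zero_le_mult_iff ennreal_mult'[symmetric]\<close>)
  also have "\<bar>q\<bar> * \<dots> = ennreal (q powr s) * (\<integral>\<^sup>+t. ennreal (indicator {0<..} t * t powr (s - 1) * exp (- (q * t))) \<partial>lborel)"
  proof (subst nn_integral_cmult)
    have "\<bar>q\<bar> * q powr (s - 1) = q powr s" using assms by (simp add: powr_mult_base)
    then show "ennreal \<bar>q\<bar> * (ennreal (q powr (s - 1)) * I) = ennreal (q powr s) * I" for I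
      by (simp only: mult.assoc[symmetric] ennreal_mult'[symmetric, OF abs_ge_zero])
  qed measurable
  finally have "ennreal (q powr (- s)) * ennreal (Gamma s)
      = ennreal (q powr (- s)) * (ennreal (q powr s) * (\<integral>\<^sup>+t. ennreal (indicator {0<..} t * t powr (s - 1) * exp (- (q * t))) \<partial>lborel))"
    by simp
  moreover have "ennreal (q powr (- s)) * ennreal (q powr s) = 1"
    using assms by (simp add: ennreal_mult'[symmetric] powr_add[symmetric])
  moreover have "ennreal (q powr (- s)) * ennreal (Gamma s) = ennreal (Gamma s * q powr (- s))"
    by (subst mult.commute) (rule ennreal_mult''[symmetric], simp)
  ultimately show ?thesis by (simp only: mult.assoc[symmetric] mult_1_left)
qed

text \<open>The kernel of the t-density is a mixture of centred Gaussian kernels with respect to a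
  Gamma weight, so its total mass follows from Tonelli's theorem.\<close>

lemma nn_integral_t_kernel:
  assumes "0 < (v::real)"
  shows "(\<integral>\<^sup>+x. ennreal ((1 + x\<^sup>2 / v) powr (- (v + 1) / 2)) \<partial>lborel)
    = ennreal (sqrt (v * pi) * Gamma (v / 2) / Gamma ((v + 1) / 2))"
proof -
  define s where "s = (v + 1) / 2"
  have s: "0 < s" using assms by (simp add: s_def)
  then have \<Gamma>: "0 < Gamma s" by (rule Gamma_real_pos)
  \<comment> \<open>Integration over \<open>y\<close> gives Gamma(s) (1 + x^2/v)^(-s). Integration
    over \<open>x\<close> first gives a Gaussian integral sqrt(pi v/y), which lowers the Gamma
    parameter from s to s - 1/2 = v/2.\<close>
  define h where "h = (\<lambda>x y::real. ennreal (indicator {0<..} y * y powr (s - 1) * exp (- ((1 + x\<^sup>2 / v) * y))))"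
  have [measurable]: "(\<lambda>(x, y). h x y) \<in> borel_measurable (lborel \<Otimes>\<^sub>M lborel)"
    unfolding h_def by measurable
  have "(\<integral>\<^sup>+x. (\<integral>\<^sup>+y. h x y \<partial>lborel) \<partial>lborel)
      = (\<integral>\<^sup>+x. ennreal (Gamma s) * ennreal ((1 + x\<^sup>2 / v) powr (- (v + 1) / 2)) \<partial>lborel)"
  proof (rule nn_integral_cong)
    fix x :: real
    have "0 < 1 + x\<^sup>2 / v" using assms by (simp add: add_pos_nonneg)
    from nn_integral_Gamma_scaled[OF s this]
    show "(\<integral>\<^sup>+y. h x y \<partial>lborel) = ennreal (Gamma s) * ennreal ((1 + x\<^sup>2 / v) powr (- (v + 1) / 2))"
      using \<Gamma> by (simp add: h_def ennreal_mult'[symmetric]) (simp add: s_def minus_divide_left)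
  qed
  also have "\<dots> = ennreal (Gamma s) * (\<integral>\<^sup>+x. ennreal ((1 + x\<^sup>2 / v) powr (- (v + 1) / 2)) \<partial>lborel)"
    by (rule nn_integral_cmult) measurable
  finally have 1: "(\<integral>\<^sup>+x. (\<integral>\<^sup>+y. h x y \<partial>lborel) \<partial>lborel) = \<dots>" .
  have "(\<integral>\<^sup>+y. (\<integral>\<^sup>+x. h x y \<partial>lborel) \<partial>lborel)
      = (\<integral>\<^sup>+y. ennreal (sqrt (v * pi)) * ennreal (indicator {0<..} y * y powr (v / 2 - 1) * exp (- (1 * y))) \<partial>lborel)"
  proof (rule nn_integral_cong)
    fix y :: real
    show "(\<integral>\<^sup>+x. h x y \<partial>lborel) = ennreal (sqrt (v * pi)) * ennreal (indicator {0<..} y * y powr (v / 2 - 1) * exp (- (1 * y)))"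
    proof (cases "0 < y")
      case True
      have "(\<integral>\<^sup>+x. h x y \<partial>lborel) = (\<integral>\<^sup>+x. ennreal (y powr (s - 1) * exp (- y)) * ennreal (exp (- (y / v * x\<^sup>2))) \<partial>lborel)"
        using True assms
        by (intro nn_integral_cong) (simp add: h_def ennreal_mult'[symmetric] exp_add[symmetric] field_simps)
      also have "\<dots> = ennreal (y powr (s - 1) * exp (- y)) * ennreal (sqrt (pi / (y / v)))"
        using True assms by (subst nn_integral_cmult) (auto simp only: nn_integral_gaussian divide_pos_pos, measurable)
      also have "\<dots> = ennreal (sqrt (v * pi) * (y powr (s - 1) / sqrt y * exp (- y)))"
        using True assms by (simp add: ennreal_mult'[symmetric] real_sqrt_divide real_sqrt_mult field_simps)
      also have "y powr (s - 1) / sqrt y = y powr (v / 2 - 1)"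
      proof -
        have "s - 1 - 1 / 2 = v / 2 - 1" by (simp add: s_def field_simps)
        then show ?thesis using True by (simp only: powr_half_sqrt[OF less_imp_le, symmetric] powr_diff[symmetric])
      qed
      finally show ?thesis using True assms by (simp add: ennreal_mult')
    next
      case False
      then show ?thesis by (simp add: h_def)
    qed
  qed
  also have "\<dots> = ennreal (sqrt (v * pi)) * ennreal (Gamma (v / 2) * 1 powr (- (v / 2)))"
    using assms nn_integral_Gamma_scaled[of "v / 2" 1] by (subst nn_integral_cmult) auto
  finally have 2: "(\<integral>\<^sup>+y. (\<integral>\<^sup>+x. h x y \<partial>lborel) \<partial>lborel) = ennreal (sqrt (v * pi) * Gamma (v / 2))"
    using assms by (simp add: ennreal_mult')
  have "(\<integral>\<^sup>+y. (\<integral>\<^sup>+x. h x y \<partial>lborel) \<partial>lborel) = (\<integral>\<^sup>+x. (\<integral>\<^sup>+y. h x y \<partial>lborel) \<partial>lborel)"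
    by (rule lborel_pair.Fubini') measurable
  then have "ennreal (1 / Gamma s) * (ennreal (Gamma s) * (\<integral>\<^sup>+x. ennreal ((1 + x\<^sup>2 / v) powr (- (v + 1) / 2)) \<partial>lborel))
      = ennreal (1 / Gamma s) * ennreal (sqrt (v * pi) * Gamma (v / 2))"
    using 1 2 by simp
  then show ?thesis
    using \<Gamma> unfolding mult.assoc[symmetric] by (simp add: ennreal_mult'[symmetric]) (simp add: s_def)
qed

lemma t_density_eq_powr: "t_density \<nu> x = t_density \<nu> 0 * (1 + x\<^sup>2 / real \<nu>) powr (- (real \<nu> + 1) / 2)"
  by (simp add: t_density_def)

lemma t_density_0_pos:
  assumes "1 \<le> \<nu>" shows "0 < t_density \<nu> 0"
  using assms by (simp add: t_density_def)

lemma even_density_t: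
  assumes "1 \<le> \<nu>"
  shows "even_density (t_density \<nu>)"
proof
  have v: "0 < real \<nu>" using assms by simp
  have q: "0 < 1 + x\<^sup>2 / real \<nu>" for x :: real using v by (simp add: add_pos_nonneg)
  show "continuous_on UNIV (t_density \<nu>)"
    unfolding t_density_def using q v by (intro continuous_intros) (auto simp: less_imp_neq[symmetric])
  show "0 < t_density \<nu> x" for x
    using q[of x] t_density_0_pos[OF assms] by (subst t_density_eq_powr) simp
  show "t_density \<nu> (- x) = t_density \<nu> x" for x by (simp add: t_density_def)
  have G: "0 < Gamma (real \<nu> / 2)" "0 < Gamma ((real \<nu> + 1) / 2)" using v by auto
  have "(\<integral>\<^sup>+x. ennreal (t_density \<nu> x) \<partial>lborel)
      = ennreal (t_density \<nu> 0) * (\<integral>\<^sup>+x. ennreal ((1 + x\<^sup>2 / real \<nu>) powr (- (real \<nu> + 1) / 2)) \<partial>lborel)"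
    using t_density_0_pos[OF assms]
    by (subst t_density_eq_powr) (simp add: ennreal_mult' nn_integral_cmult)
  also have "\<dots> = ennreal (t_density \<nu> 0 * (sqrt (\<nu> * pi) * Gamma (\<nu> / 2) / Gamma ((\<nu> + 1) / 2)))"
    using t_density_0_pos[OF assms] by (subst nn_integral_t_kernel[OF v]) (simp add: ennreal_mult'[symmetric] add.commute)
  also have "t_density \<nu> 0 * (sqrt (\<nu> * pi) * Gamma (\<nu> / 2) / Gamma ((\<nu> + 1) / 2)) = 1"
    using G v by (simp add: t_density_def less_imp_neq[symmetric] add.commute)
  finally show "(\<integral>\<^sup>+x. ennreal (t_density \<nu> x) \<partial>lborel) = 1" by simp
qed

text \<open>A polynomial tail dominates every Gaussian one: concavity of the logarithm bounds k ln(1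
  + x^2/\<nu>) by a linear function of x^2 with any prescribed slope \<epsilon>.\<close>

lemma t_density_lower_bound:
  assumes "1 \<le> \<nu>" "0 < \<epsilon>"
  obtains C where "0 < C" "\<And>x. C * exp (- (\<epsilon> * x\<^sup>2)) \<le> t_density \<nu> x"
proof -
  define k where "k = (real \<nu> + 1) / 2"
  \<comment> \<open>Inserting \<open>a * q\<close> into ln z \<le> z - 1 produces the slope k
    a/\<nu> in x^2; this choice makes it equal to \<epsilon>.\<close>
  define a where "a = \<epsilon> * real \<nu> / k"
  define C where "C = t_density \<nu> 0 * exp (k * (1 - a + ln a))"
  have k: "0 < k" by (simp add: k_def)
  have v: "0 < real \<nu>" using assms by simp
  have a: "0 < a" using k v assms by (simp add: a_def)
  have "C * exp (- (\<epsilon> * x\<^sup>2)) \<le> t_density \<nu> x" for x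
  proof -
    define q where "q = 1 + x\<^sup>2 / real \<nu>"
    have q: "0 < q" using v by (simp add: q_def add_pos_nonneg)
    have "ln (a * q) \<le> a * q - 1" using a q by (intro ln_le_minus_one) simp
    then have "ln q \<le> a * q - 1 - ln a" using a q by (simp add: ln_mult)
    then have "k * ln q \<le> k * (a * q - 1 - ln a)" using k by (intro mult_left_mono) auto
    also have "\<dots> = k * (a - 1 - ln a) + \<epsilon> * x\<^sup>2"
      using k v by (simp add: q_def a_def field_simps)
    finally have "k * (1 - a + ln a) - \<epsilon> * x\<^sup>2 \<le> - k * ln q" by (simp add: algebra_simps)
    then have "exp (k * (1 - a + ln a) - \<epsilon> * x\<^sup>2) \<le> q powr (- k)" using q by (simp add: powr_def)
    then have "t_density \<nu> 0 * exp (k * (1 - a + ln a) - \<epsilon> * x\<^sup>2) \<le> t_density \<nu> 0 * q powr (- k)"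
      using t_density_0_pos[OF assms(1)] by (intro mult_left_mono) auto
    also have "\<dots> = t_density \<nu> x" by (subst t_density_eq_powr[of \<nu> x]) (simp add: q_def k_def minus_divide_left)
    finally show ?thesis by (simp add: C_def mult.assoc exp_add[symmetric])
  qed
  moreover have "0 < C" using t_density_0_pos[OF assms(1)] by (simp add: C_def)
  ultimately show ?thesis using that by blast
qed

text \<open>The tail beyond x is at least the mass between x and x + 1, and the mean value theorem
  turns this mass into a value of the density.\<close>

lemma t_tail_lower_bound:
  assumes "1 \<le> \<nu>" "0 < \<epsilon>"
  obtains C where "0 < C" "\<And>x. C * exp (- (\<epsilon> * x\<^sup>2)) \<le> 1 - F_t \<nu> x"
proof -
  interpret t: even_density "t_density \<nu>" by (rule even_density_t[OF assms(1)])
  \<comment> \<open>Half of \<epsilon> is used because a point z within distance 1 of x satisfies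
    z^2 \<le> 2 x^2 + 2; the additive 2 costs the factor exp(-\<epsilon>).\<close>
  obtain C where C: "0 < C" "\<And>x. C * exp (- (\<epsilon> / 2 * x\<^sup>2)) \<le> t_density \<nu> x"
    using t_density_lower_bound[OF assms(1), of "\<epsilon> / 2"] assms(2) by auto
  have "C * exp (- \<epsilon>) * exp (- (\<epsilon> * x\<^sup>2)) \<le> 1 - F_t \<nu> x" for x
  proof -
    have "\<exists>z. x < z \<and> z < x + 1 \<and> F_t \<nu> (x + 1) - F_t \<nu> x = (x + 1 - x) * t_density \<nu> z"
      unfolding F_t_def by (rule MVT2) (use t.DERIV_cdf in auto)
    then obtain z where z: "x < z" "z < x + 1" "F_t \<nu> (x + 1) - F_t \<nu> x = t_density \<nu> z" by auto
    have "z\<^sup>2 \<le> 2 * x\<^sup>2 + 2 * (z - x)\<^sup>2"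
      using zero_le_power2[of "2 * x - z"] by (simp add: power2_eq_square algebra_simps)
    moreover have "(z - x)\<^sup>2 \<le> 1" using z by (simp add: power2_le_iff_abs_le[of 1] power_le_one)
    ultimately have "z\<^sup>2 \<le> 2 * x\<^sup>2 + 2" by linarith
    then have "\<epsilon> / 2 * z\<^sup>2 \<le> \<epsilon> / 2 * (2 * x\<^sup>2 + 2)" using assms(2) by (intro mult_left_mono) auto
    then have "exp (- \<epsilon> + - (\<epsilon> * x\<^sup>2)) \<le> exp (- (\<epsilon> / 2 * z\<^sup>2))" by (simp add: algebra_simps)
    then have "C * exp (- \<epsilon> + - (\<epsilon> * x\<^sup>2)) \<le> C * exp (- (\<epsilon> / 2 * z\<^sup>2))" using C(1) by simp
    also have "\<dots> \<le> t_density \<nu> z" by (rule C)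
    also have "\<dots> \<le> 1 - F_t \<nu> x" using z(3) t.cdf_bounded_prob[of "x + 1"] by (simp add: F_t_def)
    finally show ?thesis by (simp only: exp_add mult.assoc)
  qed
  then show ?thesis using that[of "C * exp (- \<epsilon>)"] C(1) by simp
qed

section \<open>Bounds for the false discovery proportion\<close>

lemma indep_vars_PiM_components:
  assumes M: "\<And>i. i \<in> I \<Longrightarrow> prob_space (M i)" and "I \<noteq> {}"
  shows "prob_space.indep_vars (PiM I M) M (\<lambda>i x. x i) I"
proof -
  interpret prob_space "PiM I M" by (rule prob_space_PiM) (rule M)
  have "distr (PiM I M) (PiM I M) (\<lambda>x. \<lambda>i\<in>I. x i) = distr (PiM I M) (PiM I M) (\<lambda>x. x)"
    by (rule distr_cong) (auto simp: space_PiM)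
  also have "\<dots> = PiM I M" by simp
  also have "\<dots> = PiM I (\<lambda>i. distr (PiM I M) (M i) (\<lambda>x. x i))"
    using M by (intro PiM_cong refl) (simp add: distr_PiM_component)
  finally show ?thesis
    by (subst indep_vars_iff_distr_eq_PiM'[OF \<open>I \<noteq> {}\<close>]) simp_all
qed

lemma integral_PiM_component:
  fixes h :: "'a \<Rightarrow> real"
  assumes N: "prob_space N" and i: "i \<in> I" and h: "integrable N h"
  shows "integrable (PiM I (\<lambda>_. N)) (\<lambda>x. h (x i))" "(\<integral>x. h (x i) \<partial>PiM I (\<lambda>_. N)) = (\<integral>x. h x \<partial>N)"
proof -
  have D: "distr (PiM I (\<lambda>_. N)) N (\<lambda>x. x i) = N"
    using N i by (intro distr_PiM_component) auto
  have [measurable]: "h \<in> borel_measurable N" using h by simp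
  have h': "integrable (distr (PiM I (\<lambda>_. N)) N (\<lambda>x. x i)) h" using h by (simp only: D)
  show "integrable (PiM I (\<lambda>_. N)) (\<lambda>x. h (x i))"
    by (rule integrable_distr[OF _ h']) (use i in measurable)
  have "(\<integral>x. h x \<partial>distr (PiM I (\<lambda>_. N)) N (\<lambda>x. x i)) = (\<integral>x. h (x i) \<partial>PiM I (\<lambda>_. N))"
    by (rule integral_distr) (use i in measurable)
  then show "(\<integral>x. h (x i) \<partial>PiM I (\<lambda>_. N)) = (\<integral>x. h x \<partial>N)" by (simp only: D)
qed

lemma Hoeffding_PiM:
  fixes f :: "'a \<Rightarrow> real"
  assumes N: "prob_space N" and f [measurable]: "f \<in> borel_measurable N" and f01: "\<And>x. f x \<in> {0..1}"
    and m: "0 < m" and \<epsilon>: "0 \<le> \<epsilon>"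
  shows "measure (PiM {..<m} (\<lambda>_. N)) {x\<in>space (PiM {..<m} (\<lambda>_. N)). real m * integral\<^sup>L N f + \<epsilon> \<le> (\<Sum>i<m. f (x i))}
      \<le> exp (- 2 * \<epsilon>\<^sup>2 / real m)" (is ?ge)
    and "measure (PiM {..<m} (\<lambda>_. N)) {x\<in>space (PiM {..<m} (\<lambda>_. N)). (\<Sum>i<m. f (x i)) \<le> real m * integral\<^sup>L N f - \<epsilon>}
      \<le> exp (- 2 * \<epsilon>\<^sup>2 / real m)" (is ?le)
proof -
  let ?P = "PiM {..<m} (\<lambda>_. N)"
  interpret prob_space ?P by (rule prob_space_PiM) (rule N)
  have distr: "distr ?P borel (\<lambda>x. f (x i)) = distr N borel f" if "i < m" for i
  proof -
    have "distr ?P borel (\<lambda>x. f (x i)) = distr (distr ?P N (\<lambda>x. x i)) borel f"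
      using that by (subst distr_distr) (auto simp: comp_def)
    also have "distr ?P N (\<lambda>x. x i) = N" using that N by (intro distr_PiM_component) auto
    finally show ?thesis .
  qed
  have m0: "0 \<in> {..<m}" using m by simp
  interpret H: Hoeffding_ineq_iid ?P "{..<m}" "\<lambda>i x. f (x i)" "\<lambda>x. f (x 0)" 0 1 "integral\<^sup>L N f"
  proof unfold_locales
    show "indep_vars (\<lambda>_. borel) (\<lambda>i x. f (x i)) {..<m}"
      by (rule indep_vars_compose2[OF indep_vars_PiM_components]) (use N m in auto)
    show "distr ?P borel (\<lambda>x. f (x i)) = distr ?P borel (\<lambda>x. f (x 0))" if "i \<in> {..<m}" for i
      using that m by (simp add: distr)
    show "random_variable borel (\<lambda>x. f (x 0))" using m0 by measurable
    show "AE x in ?P. f (x 0) \<in> {0..1}" using f01 by simp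
    have "integral\<^sup>L N f = (\<integral>x. x \<partial>distr N borel f)" by (simp add: integral_distr)
    also have "\<dots> = (\<integral>x. x \<partial>distr ?P borel (\<lambda>x. f (x 0)))" using m by (simp add: distr)
    also have "\<dots> = expectation (\<lambda>x. f (x 0))" using m0 by (subst integral_distr) auto
    finally show "integral\<^sup>L N f \<equiv> expectation (\<lambda>x. f (x 0))" by simp
  qed simp
  show ?ge using H.Hoeffding_ineq_ge[OF \<epsilon>] m by auto
  show ?le using H.Hoeffding_ineq_le[OF \<epsilon>] m by auto
qed

lemma integral_indicator_atLeast_std_normal: "(\<integral>x. of_bool (c \<le> x) \<partial>std_normal) = Phi (- c)"
proof -
  have "(\<integral>x. of_bool (c \<le> x) \<partial>std_normal) = (\<integral>x. (indicator {c..} x :: real) \<partial>std_normal)"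
    by (intro Bochner_Integration.integral_cong) (auto simp: indicator_def)
  then show ?thesis by (simp add: measure_std_normal_atLeast)
qed

text \<open>Given the scale, a null p-value lies below a threshold exactly when X_i exceeds a fixed
  point, so these are the deviation bounds for the number of such nulls. Here \<epsilon> is a
  deviation of the count and not of the frequency: \<epsilon> = d m yields exp(-2 d^2 m).\<close>

lemma Hoeffding_std_normal_count:
  assumes "0 < m" "0 \<le> \<epsilon>"
  shows "measure (PiM {..<m} (\<lambda>_. std_normal)) {x\<in>space (PiM {..<m} (\<lambda>_. std_normal)).
      real m * Phi (- c) + \<epsilon> \<le> real (card {i\<in>{..<m}. c \<le> x i})} \<le> exp (- 2 * \<epsilon>\<^sup>2 / real m)"
    and "measure (PiM {..<m} (\<lambda>_. std_normal)) {x\<in>space (PiM {..<m} (\<lambda>_. std_normal)).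
      real (card {i\<in>{..<m}. c \<le> x i}) \<le> real m * Phi (- c) - \<epsilon>} \<le> exp (- 2 * \<epsilon>\<^sup>2 / real m)"
  unfolding real_card_eq_sum_of_bool[OF finite_lessThan] integral_indicator_atLeast_std_normal[symmetric]
  by (intro Hoeffding_PiM assms prob_space_std_normal; simp add: of_bool_def)+

text \<open>The hypothesis puts enough null p-values below the step-up line at the fraction \<kappa>
  to force at least \<kappa> n rejections. At most n - n0 of them can be correct, and this number is
  divided by at least \<kappa> n.\<close>

lemma FDP_lower_bound:
  assumes "0 < \<alpha>" "n0 \<le> n" "0 < n" "0 < \<kappa>"
    and count: "real n * \<kappa> \<le> real (card {i\<in>{..<n0}. p i \<le> \<kappa> * \<alpha>})"
  shows "1 - (1 - real n0 / real n) / \<kappa> \<le> FDP \<alpha> n n0 p"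
proof -
  \<comment> \<open>Rounding up serves both sides: the line at \<open>k\<close> is at least as high
    as \<kappa> \<alpha>, and the count, being an integer, still reaches \<open>k\<close>.\<close>
  define k where "k = nat \<lceil>real n * \<kappa>\<rceil>"
  define m where "m = LSU_m \<alpha> n p"
  have k: "real n * \<kappa> \<le> real k" unfolding k_def by (rule real_nat_ceiling_ge)
  have "\<lceil>real n * \<kappa>\<rceil> \<le> int (card {i\<in>{..<n0}. p i \<le> \<kappa> * \<alpha>})"
    using count by (simp add: ceiling_le_iff)
  then have kc: "k \<le> card {i\<in>{..<n0}. p i \<le> \<kappa> * \<alpha>}" unfolding k_def by linarith
  have "\<kappa> \<le> real k / real n" using k assms(3) by (simp add: field_simps)
  then have "\<kappa> * \<alpha> \<le> real k / real n * \<alpha>" using assms(1) by (intro mult_right_mono) auto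
  then have "card {i\<in>{..<n0}. p i \<le> \<kappa> * \<alpha>} \<le> card {i\<in>{..<n}. p i \<le> real k * \<alpha> / real n}"
    using assms(2) by (intro card_mono) auto
  with kc have "k \<le> card {i\<in>{..<n}. p i \<le> real k * \<alpha> / real n}" by simp
  moreover have "card {i\<in>{..<n0}. p i \<le> \<kappa> * \<alpha>} \<le> card {..<n0}" by (intro card_mono) auto
  then have "k \<le> n" using kc assms(2) by simp
  moreover have "0 < real n * \<kappa>" using assms by simp
  then have "0 < k" using k by linarith
  ultimately have km: "k \<le> m" unfolding m_def by (intro LSU_m_ge)
  then have nm: "real n * \<kappa> \<le> real m" "0 < m" using k \<open>0 < k\<close> by auto
  have "card {i\<in>{..<n}. p i \<le> real m * \<alpha> / real n}
      \<le> card ({i\<in>{..<n0}. p i \<le> real m * \<alpha> / real n} \<union> {n0..<n})"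
    by (intro card_mono) auto
  also have "\<dots> \<le> card {i\<in>{..<n0}. p i \<le> real m * \<alpha> / real n} + (n - n0)"
    using card_Un_le by (rule order_trans) simp
  finally have "m \<le> card {i\<in>{..<n0}. p i \<le> real m * \<alpha> / real n} + (n - n0)"
    using LSU_m_card[of \<alpha> n p] by (simp add: m_def)
  then have V: "real m - (real n - real n0) \<le> real (card {i\<in>{..<n0}. p i \<le> real m * \<alpha> / real n})"
    using assms(2) by linarith
  have "(real n - real n0) / real m \<le> (real n - real n0) / (real n * \<kappa>)"
    using nm assms by (intro divide_left_mono) auto
  also have "\<dots> = (1 - real n0 / real n) / \<kappa>" using assms by (simp add: field_simps)
  finally have "1 - (1 - real n0 / real n) / \<kappa> \<le> 1 - (real n - real n0) / real m" by simp
  also have "\<dots> = (real m - (real n - real n0)) / real m" using nm by (simp add: field_simps)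
  also have "\<dots> \<le> real (card {i\<in>{..<n0}. p i \<le> real m * \<alpha> / real n}) / real m"
    using V nm by (intro divide_right_mono) auto
  also have "\<dots> = FDP \<alpha> n n0 p"
    using nm by (simp add: FDP_altdef[OF assms(1,2)] m_def[symmetric] max_def)
  finally show ?thesis .
qed

text \<open>A rejected hypothesis satisfies $p_i \le R\alpha/n$, so $1/R \le \alpha/(n p_i)$; this controls the
  false discovery proportion as long as few hypotheses are rejected.\<close>

lemma FDP_upper_bound:
  assumes \<alpha>: "0 < \<alpha>" and n0: "n0 \<le> n" and p: "\<And>i. i < n0 \<Longrightarrow> 0 < p i"
  shows "FDP \<alpha> n n0 p \<le> \<alpha> / real n * (\<Sum>i<n0. of_bool (p i \<le> \<delta> * \<alpha>) / p i)
    + of_bool (\<exists>k\<in>{1..n}. \<delta> * real n < real k \<and> k \<le> card {i\<in>{..<n0}. p i \<le> real k * \<alpha> / real n} + (n - n0))"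
    (is "_ \<le> ?A + of_bool ?U")
proof -
  define m where "m = LSU_m \<alpha> n p"
  have A: "0 \<le> ?A" using p \<alpha> by (intro mult_nonneg_nonneg sum_nonneg) (auto simp: less_imp_le)
  have F: "FDP \<alpha> n n0 p = real (card {i\<in>{..<n0}. p i \<le> real m * \<alpha> / real n}) / real (max m 1)"
    by (simp add: FDP_altdef[OF \<alpha> n0] m_def)
  show ?thesis
  proof (cases "m = 0")
    case True
    have "{i\<in>{..<n0}. p i \<le> real m * \<alpha> / real n} = {}" using p True by force
    then have "FDP \<alpha> n n0 p = 0" using F by (metis card.empty divide_eq_0_iff of_nat_0)
    then show ?thesis using A by (simp only: add_nonneg_nonneg of_bool_def split: if_split) simp
  next
    case False
    then have m: "0 < m" "m \<le> n" using LSU_m_le by (auto simp: m_def)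
    show ?thesis
    proof (cases "\<delta> * real n < real m")
      case True
      have "card {i\<in>{..<n}. p i \<le> real m * \<alpha> / real n}
          \<le> card ({i\<in>{..<n0}. p i \<le> real m * \<alpha> / real n} \<union> {n0..<n})"
        by (intro card_mono) auto
      also have "\<dots> \<le> card {i\<in>{..<n0}. p i \<le> real m * \<alpha> / real n} + (n - n0)"
        using card_Un_le by (rule order_trans) simp
      finally have "m \<le> card {i\<in>{..<n0}. p i \<le> real m * \<alpha> / real n} + (n - n0)"
        using LSU_m_card[of \<alpha> n p] by (simp add: m_def)
      \<comment> \<open>Too many rejections: \<open>m\<close> itself witnesses the event, and the
        indicator pays for the trivial bound 1.\<close>
      then have ?U using m True by (intro bexI[of _ m]) auto
      then have "of_bool ?U = (1::real)" by (simp only: of_bool_eq)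
      then show ?thesis using A FDP_bounds(2)[of \<alpha> n n0 p] by linarith
    next
      case False
      have "FDP \<alpha> n n0 p = (\<Sum>i<n0. of_bool (p i \<le> real m * \<alpha> / real n) / real m)"
      proof -
        have "max m 1 = m" using m by simp
        then show ?thesis by (simp only: F real_card_eq_sum_of_bool[OF finite_lessThan] sum_divide_distrib)
      qed
      also have "\<dots> \<le> (\<Sum>i<n0. \<alpha> / real n * (of_bool (p i \<le> \<delta> * \<alpha>) / p i))"
      proof (rule sum_mono)
        fix i assume "i \<in> {..<n0}"
        then have pi: "0 < p i" using p by simp
        show "of_bool (p i \<le> real m * \<alpha> / real n) / real m \<le> \<alpha> / real n * (of_bool (p i \<le> \<delta> * \<alpha>) / p i)"
        proof (cases "p i \<le> real m * \<alpha> / real n")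
          case True
          have "real m / real n \<le> \<delta>" using False m by (simp add: field_simps)
          then have "real m / real n * \<alpha> \<le> \<delta> * \<alpha>" using \<alpha> by (intro mult_right_mono) auto
          then have "p i \<le> \<delta> * \<alpha>" using True by simp
          then show ?thesis using True m pi by (simp add: field_simps)
        qed (use pi \<alpha> in auto)
      qed
      also have "\<dots> = ?A" by (simp add: sum_distrib_left)
      finally show ?thesis by simp
    qed
  qed
qed

section \<open>The limit for a fixed scale\<close>

text \<open>The studentizing scale is frozen at \<open>s\<close>, so that the null p-values are
  independent and identically distributed functions of X_1, ..., X_n0.\<close>

locale conditional_t_model =
  fixes \<nu> :: nat and \<alpha> :: real and n0 :: "nat \<Rightarrow> nat" and s :: real
  assumes \<nu>: "1 \<le> \<nu>" and \<alpha>: "0 < \<alpha>" and \<alpha>1: "\<alpha> < 1" and n0: "\<And>n. n0 n \<le> n"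
    and ratio: "(\<lambda>n. real (n0 n) / real n) \<longlonglongrightarrow> 1" and s: "0 < s"
begin

sublocale t: even_density "t_density \<nu>" by (rule even_density_t[OF \<nu>])

definition G :: "real \<Rightarrow> real" where "G x = 1 - F_t \<nu> x"

definition pv :: "nat \<Rightarrow> (nat \<Rightarrow> real) \<Rightarrow> nat \<Rightarrow> real" where
  "pv m x i = (if i < m then G (x i / s) else 0)"

abbreviation PX :: "nat \<Rightarrow> (nat \<Rightarrow> real) measure" where "PX m \<equiv> PiM {..<m} (\<lambda>_. std_normal)"

lemma G_pos: "0 < G x"
  using t.cdf_less_1 by (simp add: G_def F_t_def)

lemma G_le_iff: "G x \<le> G y \<longleftrightarrow> y \<le> x"
  using t.cdf_less_iff[of x y] by (simp add: G_def F_t_def not_less[symmetric])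

lemma continuous_on_G: "continuous_on A G"
  unfolding G_def[abs_def] F_t_def[abs_def]
  by (intro continuous_at_imp_continuous_on ballI continuous_diff continuous_const t.isCont_cdf_density)

lemma G_measurable [measurable]: "G \<in> borel_measurable borel"
  by (rule borel_measurable_continuous_onI[OF continuous_on_G])

lemma G_at_top: "(G \<longlongrightarrow> 0) at_top"
  using t.tail_at_top by (simp add: G_def[abs_def] F_t_def[abs_def])

lemma G_at_bot: "(G \<longlongrightarrow> 1) at_bot"
  using tendsto_diff[OF tendsto_const t.cdf_lim_at_bot, of 1] by (simp add: G_def[abs_def] F_t_def[abs_def])

lemma G_surj:
  assumes "0 < t" "t < 1"
  obtains c where "G c = t"
proof -
  obtain b where b: "G b < t"
    using eventually_happens'[OF _ order_tendstoD(2)[OF G_at_top assms(1)]] by auto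
  obtain a where a: "t < G a"
    using eventually_happens'[OF _ order_tendstoD(1)[OF G_at_bot assms(2)]] by auto
  have "a \<le> b" using a b G_le_iff[of b a] by simp
  then have "\<exists>c. a \<le> c \<and> c \<le> b \<and> G c = t"
    using a b by (intro IVT2') (auto intro: continuous_on_G)
  then show ?thesis using that by blast
qed

lemma prob_space_PX: "prob_space (PX m)"
  by (intro prob_space_PiM) simp

lemma pv_measurable [measurable]: "(\<lambda>x. pv m x i) \<in> borel_measurable (PX m)"
proof (cases "i < m")
  case True
  then have "i \<in> {..<m}" by simp
  then show ?thesis using True unfolding pv_def by simp measurable
qed (simp add: pv_def)

lemma FDP_measurable [measurable]:
  "(\<lambda>x. FDP \<alpha> n (n0 n) (pv (n0 n) x)) \<in> borel_measurable (PX (n0 n))"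
  by (rule measurable_FDP[OF \<alpha> n0 pv_measurable])

lemma FDP_integrable: "integrable (PX (n0 n)) (\<lambda>x. FDP \<alpha> n (n0 n) (pv (n0 n) x))"
proof -
  interpret prob_space "PX (n0 n)" by (rule prob_space_PX)
  show ?thesis
    by (rule integrable_const_bound[where B = 1]) (use FDP_bounds in auto)
qed

lemma pv_le_iff: "i < m \<Longrightarrow> pv m x i \<le> G c \<longleftrightarrow> s * c \<le> x i"
  using s by (simp add: pv_def G_le_iff field_simps)

lemma n0_at_top: "filterlim n0 at_top sequentially"
proof -
  have "eventually (\<lambda>n. 1/2 < real (n0 n) / real n) sequentially"
    by (rule order_tendstoD(1)[OF ratio]) simp
  then have "eventually (\<lambda>n. real n / 2 \<le> real (n0 n)) sequentially"
    using eventually_gt_at_top[of 0] by eventually_elim (simp add: field_simps)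
  moreover have "filterlim (\<lambda>n. real n / 2) at_top sequentially" by real_asymp
  ultimately have "filterlim (\<lambda>n. real (n0 n)) at_top sequentially"
    by (rule filterlim_at_top_mono[rotated])
  then show ?thesis by (simp add: filterlim_sequentially_iff_filterlim_real)
qed

lemma n0_eventually_pos: "eventually (\<lambda>n. 0 < n0 n) sequentially"
  using n0_at_top unfolding filterlim_at_top by (auto simp: Suc_le_eq dest: spec[of _ 1])

section \<open>Scales with a crossing\<close>

lemma inner_tendsto_1:
  assumes c: "G c < \<alpha> * Phi (- (s * c))"
  shows "(\<lambda>n. \<integral>x. FDP \<alpha> n (n0 n) (pv (n0 n) x) \<partial>PX (n0 n)) \<longlonglongrightarrow> 1"
proof -
  define q where "q = Phi (- (s * c))"
  have "G c / \<alpha> < q" using c \<alpha> by (simp add: q_def field_simps)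
  \<comment> \<open>A rejected fraction with slack on both sides: G(c) < \<kappa> \<alpha> keeps the
    threshold below the step-up line, and \<kappa> < q leaves room for fluctuations of the
    count.\<close>
  then obtain \<kappa> where \<kappa>: "G c / \<alpha> < \<kappa>" "\<kappa> < q" using dense by blast
  have "0 < G c / \<alpha>" using G_pos \<alpha> by simp
  then have \<kappa>0: "0 < \<kappa>" using \<kappa> by simp
  have Gc: "G c \<le> \<kappa> * \<alpha>" using \<kappa> \<alpha> by (simp add: field_simps)
  \<comment> \<open>One half of the slack absorbs the random deviation; the other covers n0 < n,
    because n0/n > \<kappa>/(\<kappa> + d) implies n \<kappa> \<le> n0 (\<kappa> + d).\<close>
  define d where "d = (q - \<kappa>) / 2"
  have d: "0 < d" "q - d = \<kappa> + d" using \<kappa> by (auto simp: d_def field_simps)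
  let ?P = "\<lambda>n. PX (n0 n)"
  define B where "B n = {x\<in>space (?P n). real (card {i\<in>{..<n0 n}. s * c \<le> x i}) \<le> real (n0 n) * q - real (n0 n) * d}" for n
  have B [measurable]: "B n \<in> sets (?P n)" for n
    unfolding B_def real_card_eq_sum_of_bool[OF finite_lessThan] of_bool_def by measurable
  have lower: "1 - (1 - real (n0 n) / real n) / \<kappa> - exp (- 2 * d\<^sup>2 * real (n0 n))
      \<le> (\<integral>x. FDP \<alpha> n (n0 n) (pv (n0 n) x) \<partial>?P n)"
    if n: "0 < n" "0 < n0 n" "\<kappa> / (\<kappa> + d) < real (n0 n) / real n" for n
  proof -
    interpret prob_space "?P n" by (rule prob_space_PX)
    let ?L = "1 - (1 - real (n0 n) / real n) / \<kappa>"
    have L1: "?L \<le> 1" using \<kappa>0 n n0[of n] by (simp add: field_simps)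
    have nk: "real n * \<kappa> \<le> real (n0 n) * (\<kappa> + d)" using n \<kappa>0 d by (simp add: field_simps)
    have "?L - indicator (B n) x \<le> FDP \<alpha> n (n0 n) (pv (n0 n) x)" if x: "x \<in> space (?P n)" for x
    proof (cases "x \<in> B n")
      case True
      then show ?thesis using L1 FDP_bounds(1)[of \<alpha> n "n0 n" "pv (n0 n) x"] by simp
    next
      case False
      then have "real (n0 n) * (\<kappa> + d) < real (card {i\<in>{..<n0 n}. s * c \<le> x i})"
        using x unfolding B_def d(2)[symmetric] by (simp add: algebra_simps)
      also have "card {i\<in>{..<n0 n}. s * c \<le> x i} \<le> card {i\<in>{..<n0 n}. pv (n0 n) x i \<le> \<kappa> * \<alpha>}"
        using pv_le_iff[of _ "n0 n" x c] Gc by (intro card_mono) (auto intro: order_trans)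
      finally have "?L \<le> FDP \<alpha> n (n0 n) (pv (n0 n) x)"
        using nk by (intro FDP_lower_bound \<alpha> n0 n \<kappa>0) auto
      then show ?thesis using False by simp
    qed
    moreover have ind_int: "integrable (?P n) (indicator (B n) :: _ \<Rightarrow> real)"
      by (rule integrable_real_indicator[OF B]) (simp add: emeasure_eq_measure)
    ultimately have "(\<integral>x. ?L - indicator (B n) x \<partial>?P n) \<le> (\<integral>x. FDP \<alpha> n (n0 n) (pv (n0 n) x) \<partial>?P n)"
      by (intro integral_mono FDP_integrable Bochner_Integration.integrable_diff) auto
    moreover have "(\<integral>x. ?L - indicator (B n) x \<partial>?P n) = ?L - prob (B n)"
      using ind_int by (subst Bochner_Integration.integral_diff) (auto simp: prob_space)
    moreover have "prob (B n) \<le> exp (- 2 * (real (n0 n) * d)\<^sup>2 / real (n0 n))"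
      unfolding B_def q_def using n d by (intro Hoeffding_std_normal_count) auto
    moreover have "- 2 * (real (n0 n) * d)\<^sup>2 / real (n0 n) = - 2 * d\<^sup>2 * real (n0 n)"
      using n by (simp add: power2_eq_square)
    ultimately show ?thesis by simp
  qed
  show ?thesis
  proof (rule tendsto_sandwich)
    have "\<kappa> / (\<kappa> + d) < 1" using d \<kappa>0 by simp
    from order_tendstoD(1)[OF ratio this]
    show "\<forall>\<^sub>F n in sequentially. 1 - (1 - real (n0 n) / real n) / \<kappa> - exp (- 2 * d\<^sup>2 * real (n0 n))
      \<le> (\<integral>x. FDP \<alpha> n (n0 n) (pv (n0 n) x) \<partial>?P n)"
      using eventually_gt_at_top[of 0] n0_eventually_pos
      by eventually_elim (rule lower)
    show "\<forall>\<^sub>F n in sequentially. (\<integral>x. FDP \<alpha> n (n0 n) (pv (n0 n) x) \<partial>?P n) \<le> 1"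
    proof (rule always_eventually, rule allI)
      fix n
      interpret prob_space "?P n" by (rule prob_space_PX)
      show "(\<integral>x. FDP \<alpha> n (n0 n) (pv (n0 n) x) \<partial>?P n) \<le> 1"
        using integral_mono[OF FDP_integrable integrable_const[of 1]] FDP_bounds by (simp add: prob_space)
    qed
    have "((\<lambda>y. exp (- 2 * d\<^sup>2 * real y)) \<longlonglongrightarrow> 0)"
      using d by real_asymp
    from filterlim_compose[OF this n0_at_top]
    have "(\<lambda>n. 1 - (1 - real (n0 n) / real n) / \<kappa> - exp (- 2 * d\<^sup>2 * real (n0 n))) \<longlonglongrightarrow> 1 - (1 - 1) / \<kappa> - 0"
      using \<kappa>0 by (intro tendsto_intros ratio) auto
    then show "(\<lambda>n. 1 - (1 - real (n0 n) / real n) / \<kappa> - exp (- 2 * d\<^sup>2 * real (n0 n))) \<longlonglongrightarrow> 1" by simp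
  qed simp
qed

text \<open>Thresholds between \<delta> \<alpha> and \<alpha> correspond to a compact range of c, on
  which the continuous gap attains a positive minimum. The lower cutoff is essential: both curves
  tend to 0, so no gap is uniform over all thresholds.\<close>

lemma uniform_gap:
  assumes gap: "\<And>c. \<alpha> * Phi (- (s * c)) < G c" and \<delta>: "0 < \<delta>" "\<delta> \<le> 1"
  obtains \<eta> where "0 < \<eta>"
    "\<And>t. \<lbrakk>\<delta> * \<alpha> \<le> t; t \<le> \<alpha>\<rbrakk> \<Longrightarrow> \<exists>c. G c = t \<and> Phi (- (s * c)) \<le> t / \<alpha> - \<eta>"
proof -
  obtain a where a: "G a = \<alpha>" using G_surj[OF \<alpha> \<alpha>1] .
  have "\<delta> * \<alpha> \<le> \<alpha>" using \<delta> \<alpha> by simp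
  then have "\<delta> * \<alpha> < 1" using \<alpha>1 by simp
  then obtain b where b: "G b = \<delta> * \<alpha>" using G_surj[of "\<delta> * \<alpha>"] \<delta> \<alpha> by auto
  have ab: "a \<le> b" using a b \<open>\<delta> * \<alpha> \<le> \<alpha>\<close> G_le_iff[of b a] by simp
  define g where "g c = G c / \<alpha> - Phi (- (s * c))" for c
  have "continuous_on {a..b} (\<lambda>c. Phi (- (s * c)))"
    by (rule continuous_on_compose2[of UNIV Phi]) (auto intro!: continuous_intros continuous_at_imp_continuous_on isCont_Phi)
  then have "continuous_on {a..b} g" unfolding g_def
    using \<alpha> by (intro continuous_intros continuous_on_G) auto
  then obtain c0 where c0: "c0 \<in> {a..b}" "\<And>c. c \<in> {a..b} \<Longrightarrow> g c0 \<le> g c"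
    using continuous_attains_inf[of "{a..b}" g] ab by auto
  show ?thesis
  proof (rule that)
    show "0 < g c0" using gap[of c0] \<alpha> by (simp add: g_def field_simps)
    fix t assume t: "\<delta> * \<alpha> \<le> t" "t \<le> \<alpha>"
    have "\<exists>c. a \<le> c \<and> c \<le> b \<and> G c = t"
      using a b t ab by (intro IVT2') (auto intro: continuous_on_G)
    then obtain c where c: "c \<in> {a..b}" "G c = t" by auto
    with c0(2)[OF c(1)] show "\<exists>c. G c = t \<and> Phi (- (s * c)) \<le> t / \<alpha> - g c0"
      by (intro exI[of _ c]) (simp add: g_def[of c])
  qed
qed

lemma integrable_inverse_p_value: "integrable std_normal (\<lambda>x. 1 / G (x / s))"
proof -
  \<comment> \<open>After rescaling by s this rate gives G(x/s) \<ge> C exp(-x^2/4). It uses up half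
    of the normal exponent x^2/2 and leaves a multiple of the density with variance 2.\<close>
  have "0 < s\<^sup>2 / 4" using s by simp
  then obtain C where C: "0 < C" "\<And>x. C * exp (- (s\<^sup>2 / 4 * x\<^sup>2)) \<le> 1 - F_t \<nu> x"
    using t_tail_lower_bound[OF \<nu>] by metis
  have "integrable lborel (\<lambda>x. sqrt 2 / C * normal_density 0 (sqrt 2) x)" by simp
  then have "integrable lborel (\<lambda>x. std_normal_density x * (1 / G (x / s)))"
  proof (rule Bochner_Integration.integrable_bound)
    show "AE x in lborel. norm (std_normal_density x * (1 / G (x / s))) \<le> norm (sqrt 2 / C * normal_density 0 (sqrt 2) x)"
    proof (rule AE_I2)
      fix x :: real
      have "C * exp (- (x\<^sup>2 / 4)) \<le> G (x / s)"
        using C(2)[of "x / s"] s by (simp add: G_def power_divide)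
      then have "1 / G (x / s) \<le> 1 / (C * exp (- (x\<^sup>2 / 4)))"
        using C(1) G_pos by (intro divide_left_mono mult_pos_pos) auto
      then have "std_normal_density x * (1 / G (x / s)) \<le> std_normal_density x * (1 / (C * exp (- (x\<^sup>2 / 4))))"
        by (intro mult_left_mono) auto
      also have "\<dots> = sqrt 2 / C * normal_density 0 (sqrt 2) x"
      proof -
        have "exp (- (x\<^sup>2 / 2)) / exp (- (x\<^sup>2 / 4)) = exp (- (x\<^sup>2 / 4))"
          by (simp add: exp_diff[symmetric])
        then show ?thesis
          using C(1) by (simp add: normal_density_def std_normal_density_def real_sqrt_mult field_simps)
      qed
      finally show "norm (std_normal_density x * (1 / G (x / s))) \<le> norm (sqrt 2 / C * normal_density 0 (sqrt 2) x)"
        using G_pos[of "x / s"] C(1) by (simp add: abs_mult)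
    qed
  qed measurable
  then show ?thesis
    unfolding std_normal_def by (subst integrable_density) auto
qed

text \<open>Dominated convergence with majorant 1/p along \<delta> = 1/(j + 1): since every p-value
  is positive, the truncated integrand is eventually 0 at each point.\<close>

lemma small_p_value_contribution:
  assumes "0 < \<epsilon>"
  obtains \<delta> where "0 < \<delta>" "\<delta> \<le> 1" "(\<integral>x. of_bool (G (x / s) \<le> \<delta> * \<alpha>) / G (x / s) \<partial>std_normal) < \<epsilon>"
proof -
  let ?h = "\<lambda>j x. of_bool (G (x / s) \<le> 1 / real (Suc j) * \<alpha>) / G (x / s)"
  have "(\<lambda>j. \<integral>x. ?h j x \<partial>std_normal) \<longlonglongrightarrow> (\<integral>x. 0 \<partial>std_normal)"
  proof (rule integral_dominated_convergence[OF _ _ integrable_inverse_p_value])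
    show "AE x in std_normal. (\<lambda>j. ?h j x) \<longlonglongrightarrow> 0"
    proof (rule AE_I2)
      fix x
      have "(\<lambda>j. 1 / real (Suc j) * \<alpha>) \<longlonglongrightarrow> 0" by real_asymp
      from order_tendstoD(2)[OF this G_pos[of "x / s"]]
      have "eventually (\<lambda>j. ?h j x = 0) sequentially" by eventually_elim auto
      then show "(\<lambda>j. ?h j x) \<longlonglongrightarrow> 0" by (rule tendsto_eventually)
    qed
    show "AE x in std_normal. norm (?h j x) \<le> 1 / G (x / s)" for j
      using G_pos by (auto simp: less_imp_le)
  qed (simp_all add: of_bool_def)
  then have "(\<lambda>j. \<integral>x. ?h j x \<partial>std_normal) \<longlonglongrightarrow> 0" by simp
  from eventually_happens'[OF _ order_tendstoD(2)[OF this assms]]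
  obtain j where "(\<integral>x. ?h j x \<partial>std_normal) < \<epsilon>" by auto
  then show ?thesis by (intro that[of "1 / real (Suc j)"]) auto
qed

lemma inner_tendsto_0:
  assumes gap: "\<And>c. \<alpha> * Phi (- (s * c)) < G c"
  shows "(\<lambda>n. \<integral>x. FDP \<alpha> n (n0 n) (pv (n0 n) x) \<partial>PX (n0 n)) \<longlonglongrightarrow> 0"
proof (rule tendstoI)
  fix \<epsilon> :: real assume \<epsilon>: "0 < \<epsilon>"
  \<comment> \<open>Half of \<epsilon> is reserved for the small p-values, whose contribution
    carries the factor \<alpha>; the other half is for the event of many rejections.\<close>
  then have "0 < \<epsilon> / (2 * \<alpha>)" using \<alpha> by simp
  then obtain \<delta> where \<delta>: "0 < \<delta>" "\<delta> \<le> 1"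
    and small: "(\<integral>x. of_bool (G (x / s) \<le> \<delta> * \<alpha>) / G (x / s) \<partial>std_normal) < \<epsilon> / (2 * \<alpha>)"
    by (rule small_p_value_contribution)
  obtain \<eta> where \<eta>: "0 < \<eta>"
    "\<And>t. \<lbrakk>\<delta> * \<alpha> \<le> t; t \<le> \<alpha>\<rbrakk> \<Longrightarrow> \<exists>c. G c = t \<and> Phi (- (s * c)) \<le> t / \<alpha> - \<eta>"
    using uniform_gap[OF gap \<delta>] by metis
  define h where "h x = of_bool (G (x / s) \<le> \<delta> * \<alpha>) / G (x / s)" for x
  have [measurable]: "h \<in> borel_measurable borel" unfolding h_def of_bool_def by measurable
  have h_nonneg: "0 \<le> h x" for x using G_pos[of "x / s"] by (simp add: h_def)
  have h: "integrable std_normal h"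
    by (rule Bochner_Integration.integrable_bound[OF integrable_inverse_p_value])
       (auto simp: h_def)
  define H where "H = (\<integral>x. h x \<partial>std_normal)"
  have H: "H < \<epsilon> / (2 * \<alpha>)" using small by (simp add: H_def h_def)
  have H0: "0 \<le> H" unfolding H_def by (intro integral_nonneg_AE) (simp add: h_nonneg)
  let ?P = "\<lambda>n. PX (n0 n)"
  \<comment> \<open>The event that \<open>k\<close> meets the step-up condition, with all n - n0
    false hypotheses counted since their p-values are 0.\<close>
  define K where "K n k = {x\<in>space (?P n). k \<le> card {i\<in>{..<n0 n}. pv (n0 n) x i \<le> real k * \<alpha> / real n} + (n - n0 n)}" for n k
  have K [measurable]: "K n k \<in> sets (?P n)" for n k
  proof -
    have "K n k = {x\<in>space (?P n). real k \<le> real (card {i\<in>{..<n0 n}. pv (n0 n) x i \<le> real k * \<alpha> / real n}) + real (n - n0 n)}"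
      unfolding K_def of_nat_add[symmetric] of_nat_le_iff ..
    also have "\<dots> \<in> sets (?P n)"
      unfolding real_card_eq_sum_of_bool[OF finite_lessThan] of_bool_def by measurable
    finally show ?thesis .
  qed
  define I where "I n = {k\<in>{1..n}. \<delta> * real n < real k}" for n
  \<comment> \<open>Each level \<open>k\<close> has its own deterministic threshold k \<alpha>/n, so
    a union bound replaces uniform convergence of the empirical distribution; its factor of at most
    n is beaten by the exponential bound.\<close>
  define U where "U n = (\<Union>k\<in>I n. K n k)" for n
  have U [measurable]: "U n \<in> sets (?P n)" for n unfolding U_def I_def by measurable
  have K_bound: "measure (?P n) (K n k) \<le> exp (- (\<eta>\<^sup>2 * real (n0 n)) / 2)"
    if n: "0 < n0 n" "1 - \<eta> / 4 < real (n0 n) / real n" "1 / 2 < real (n0 n) / real n" and k: "k \<in> I n" for n k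
  proof -
    interpret prob_space "?P n" by (rule prob_space_PX)
    have n_pos: "0 < n" using n n0[of n] by simp
    define r where "r = real k / real n"
    have r: "\<delta> \<le> r" "r \<le> 1" using k n_pos by (auto simp: r_def I_def field_simps)
    have "\<delta> * \<alpha> \<le> r * \<alpha>" "r * \<alpha> \<le> \<alpha>" using r \<alpha> by auto
    from \<eta>(2)[OF this] obtain c where c: "G c = r * \<alpha>" "Phi (- (s * c)) \<le> r - \<eta>" using \<alpha> by auto
    \<comment> \<open>The false hypotheses consume half of \<eta>, and the remaining
      \<open>\<eta> / 2\<close> is the deviation for Hoeffding's inequality. The factor 2 between n
      and n0 turns \<eta>/4 into \<eta>/2.\<close>
    have gap_n: "real n - real (n0 n) \<le> real (n0 n) * (\<eta> / 2)"
    proof -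
      have "real n - real (n0 n) \<le> real n * (\<eta> / 4)" using n(2) n_pos by (simp add: field_simps)
      also have "\<dots> \<le> 2 * real (n0 n) * (\<eta> / 4)" using n(3) n_pos \<eta>(1) by (intro mult_right_mono) (auto simp: field_simps)
      finally show ?thesis by (simp add: mult.commute)
    qed
    have "real (n0 n) * Phi (- (s * c)) \<le> real (n0 n) * (r - \<eta>)" using c by (intro mult_left_mono) auto
    moreover have "real (n0 n) * r \<le> real n * r" using n0[of n] r \<delta> by (intro mult_right_mono) auto
    moreover have "real n * r = real k" using n_pos by (simp add: r_def)
    ultimately have mean: "real (n0 n) * Phi (- (s * c)) + real (n0 n) * (\<eta> / 2) \<le> real k - (real n - real (n0 n))"
      using gap_n by (simp add: algebra_simps)
    have "K n k \<subseteq> {x\<in>space (?P n). real (n0 n) * Phi (- (s * c)) + real (n0 n) * (\<eta> / 2) \<le> real (card {i\<in>{..<n0 n}. s * c \<le> x i})}"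
    proof
      fix x assume x: "x \<in> K n k"
      have "{i\<in>{..<n0 n}. pv (n0 n) x i \<le> real k * \<alpha> / real n} = {i\<in>{..<n0 n}. s * c \<le> x i}"
        using pv_le_iff[of _ "n0 n" x c] c(1) by (auto simp: r_def)
      then have "k \<le> card {i\<in>{..<n0 n}. s * c \<le> x i} + (n - n0 n)" using x by (simp add: K_def)
      then have "real k - (real n - real (n0 n)) \<le> real (card {i\<in>{..<n0 n}. s * c \<le> x i})"
        using n0[of n] by linarith
      then show "x \<in> {x\<in>space (?P n). real (n0 n) * Phi (- (s * c)) + real (n0 n) * (\<eta> / 2) \<le> real (card {i\<in>{..<n0 n}. s * c \<le> x i})}"
        using mean x by (simp add: K_def)
    qed
    then have "prob (K n k) \<le> prob {x\<in>space (?P n). real (n0 n) * Phi (- (s * c)) + real (n0 n) * (\<eta> / 2) \<le> real (card {i\<in>{..<n0 n}. s * c \<le> x i})}"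
      unfolding real_card_eq_sum_of_bool[OF finite_lessThan] of_bool_def by (intro finite_measure_mono) measurable
    also have "\<dots> \<le> exp (- 2 * (real (n0 n) * (\<eta> / 2))\<^sup>2 / real (n0 n))"
      using n \<eta> by (intro Hoeffding_std_normal_count) auto
    also have "- 2 * (real (n0 n) * (\<eta> / 2))\<^sup>2 / real (n0 n) = - (\<eta>\<^sup>2 * real (n0 n)) / 2"
      using n by (simp add: power2_eq_square)
    finally show ?thesis .
  qed
  have upper: "(\<integral>x. FDP \<alpha> n (n0 n) (pv (n0 n) x) \<partial>?P n) \<le> \<alpha> * H + 2 * real (n0 n) * exp (- (\<eta>\<^sup>2 * real (n0 n)) / 2)"
    if n: "0 < n0 n" "1 - \<eta> / 4 < real (n0 n) / real n" "1 / 2 < real (n0 n) / real n" for n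
  proof -
    interpret prob_space "?P n" by (rule prob_space_PX)
    have n_pos: "0 < n" using n n0[of n] by simp
    have comp: "integrable (?P n) (\<lambda>x. h (x i))" "(\<integral>x. h (x i) \<partial>?P n) = H" if "i < n0 n" for i
      using integral_PiM_component[OF prob_space_std_normal _ h, of i "{..<n0 n}"] that by (auto simp: H_def)
    have "FDP \<alpha> n (n0 n) (pv (n0 n) x) \<le> \<alpha> / real n * (\<Sum>i<n0 n. h (x i)) + indicator (U n) x"
      if x: "x \<in> space (?P n)" for x
    proof -
      have "FDP \<alpha> n (n0 n) (pv (n0 n) x) \<le> \<alpha> / real n * (\<Sum>i<n0 n. of_bool (pv (n0 n) x i \<le> \<delta> * \<alpha>) / pv (n0 n) x i)
        + of_bool (\<exists>k\<in>{1..n}. \<delta> * real n < real k \<and> k \<le> card {i\<in>{..<n0 n}. pv (n0 n) x i \<le> real k * \<alpha> / real n} + (n - n0 n))"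
        by (rule FDP_upper_bound[OF \<alpha> n0]) (simp add: pv_def G_pos)
      also have "(\<Sum>i<n0 n. of_bool (pv (n0 n) x i \<le> \<delta> * \<alpha>) / pv (n0 n) x i) = (\<Sum>i<n0 n. h (x i))"
        by (intro sum.cong) (auto simp: pv_def h_def)
      also have "of_bool (\<exists>k\<in>{1..n}. \<delta> * real n < real k \<and> k \<le> card {i\<in>{..<n0 n}. pv (n0 n) x i \<le> real k * \<alpha> / real n} + (n - n0 n))
          = (indicator (U n) x :: real)"
        unfolding indicator_def of_bool_def U_def I_def K_def using x by auto
      finally show ?thesis .
    qed
    moreover have sum_int: "integrable (?P n) (\<lambda>x. \<alpha> / real n * (\<Sum>i<n0 n. h (x i)))"
      using comp(1) by (intro Bochner_Integration.integrable_mult_right Bochner_Integration.integrable_sum) auto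
    moreover have ind_int: "integrable (?P n) (indicator (U n) :: _ \<Rightarrow> real)"
      by (intro integrable_real_indicator) (auto simp: emeasure_eq_measure)
    ultimately have "(\<integral>x. FDP \<alpha> n (n0 n) (pv (n0 n) x) \<partial>?P n) \<le> (\<integral>x. \<alpha> / real n * (\<Sum>i<n0 n. h (x i)) + indicator (U n) x \<partial>?P n)"
      by (intro integral_mono FDP_integrable Bochner_Integration.integrable_add) auto
    also have "\<dots> = \<alpha> / real n * (\<Sum>i<n0 n. \<integral>x. h (x i) \<partial>?P n) + prob (U n)"
      using comp(1) sum_int ind_int
      by (subst Bochner_Integration.integral_add, simp, simp, subst Bochner_Integration.integral_mult_right_zero,
          subst Bochner_Integration.integral_sum) auto
    also have "(\<Sum>i<n0 n. \<integral>x. h (x i) \<partial>?P n) = real (n0 n) * H"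
      using comp(2) by simp
    also have "\<alpha> / real n * (real (n0 n) * H) \<le> \<alpha> * H"
    proof -
      have "real (n0 n) / real n \<le> 1" using n0[of n] n_pos by simp
      then have "real (n0 n) / real n * (\<alpha> * H) \<le> 1 * (\<alpha> * H)" using \<alpha> H0 by (intro mult_right_mono) auto
      then show ?thesis by (simp add: field_simps)
    qed
    also have "prob (U n) \<le> 2 * real (n0 n) * exp (- (\<eta>\<^sup>2 * real (n0 n)) / 2)"
    proof -
      have "prob (U n) \<le> (\<Sum>k\<in>I n. prob (K n k))"
        unfolding U_def by (rule finite_measure_subadditive_finite) (auto simp: I_def)
      also have "\<dots> \<le> (\<Sum>k\<in>I n. exp (- (\<eta>\<^sup>2 * real (n0 n)) / 2))"
        by (intro sum_mono K_bound n)
      also have "\<dots> = real (card (I n)) * exp (- (\<eta>\<^sup>2 * real (n0 n)) / 2)" by simp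
      also have "\<dots> \<le> 2 * real (n0 n) * exp (- (\<eta>\<^sup>2 * real (n0 n)) / 2)"
      proof (rule mult_right_mono)
        have "card (I n) \<le> card {1..n}" by (intro card_mono) (auto simp: I_def)
        moreover have "real n \<le> 2 * real (n0 n)" using n(3) n_pos by (simp add: field_simps)
        ultimately show "real (card (I n)) \<le> 2 * real (n0 n)" by simp
      qed simp
      finally show ?thesis .
    qed
    finally show ?thesis by simp
  qed
  have "((\<lambda>y. 2 * real y * exp (- (\<eta>\<^sup>2 * real y) / 2)) \<longlonglongrightarrow> 0)"
    using \<eta>(1) by real_asymp
  from order_tendstoD(2)[OF filterlim_compose[OF this n0_at_top], of "\<epsilon> / 2"]
  have "\<forall>\<^sub>F n in sequentially. 2 * real (n0 n) * exp (- (\<eta>\<^sup>2 * real (n0 n)) / 2) < \<epsilon> / 2" using \<epsilon> by simp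
  moreover have "\<forall>\<^sub>F n in sequentially. 1 - \<eta> / 4 < real (n0 n) / real n"
    by (rule order_tendstoD(1)[OF ratio]) (use \<eta> in simp)
  moreover have "\<forall>\<^sub>F n in sequentially. 1 / 2 < real (n0 n) / real n"
    by (rule order_tendstoD(1)[OF ratio]) simp
  ultimately show "\<forall>\<^sub>F n in sequentially. dist (\<integral>x. FDP \<alpha> n (n0 n) (pv (n0 n) x) \<partial>?P n) 0 < \<epsilon>"
    using n0_eventually_pos
  proof eventually_elim
    case (elim n)
    have "\<alpha> * H < \<epsilon> / 2" using H \<alpha> by (simp add: field_simps)
    moreover have "0 \<le> (\<integral>x. FDP \<alpha> n (n0 n) (pv (n0 n) x) \<partial>?P n)"
      by (intro integral_nonneg_AE) (simp add: FDP_bounds)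
    ultimately show ?case using upper[OF elim(4,2,3)] elim(1) by simp
  qed
qed

end

section \<open>The critical scale for many degrees of freedom\<close>

text \<open>Log-convexity at the midpoint of x and x + 1 gives Gamma(x + 1/2)^2 \<le> Gamma(x)
  Gamma(x + 1) = x Gamma(x)^2.\<close>

lemma Gamma_half_le:
  assumes "0 < (x::real)"
  shows "Gamma (x + 1 / 2) \<le> sqrt x * Gamma x"
proof -
  have "(ln \<circ> Gamma) ((1 - 1 / 2) *\<^sub>R x + (1 / 2) *\<^sub>R (x + 1)) \<le> (1 - 1 / 2) * (ln \<circ> Gamma) x + (1 / 2) * (ln \<circ> Gamma) (x + 1)"
    by (rule convex_onD[OF log_convex_Gamma_real]) (use assms in auto)
  moreover have "(1 - 1 / 2) *\<^sub>R x + (1 / 2) *\<^sub>R (x + 1) = x + 1 / 2" by (simp add: field_simps)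
  moreover have "Gamma (x + 1) = x * Gamma x" using assms by (intro Gamma_plus1) (auto elim!: nonpos_Ints_cases)
  ultimately have "ln (Gamma (x + 1 / 2)) \<le> ln (sqrt x * Gamma x)"
    using assms less_imp_neq[OF Gamma_real_pos[of x]] by (simp add: ln_mult ln_sqrt field_simps)
  then show ?thesis using assms Gamma_real_pos[of x] Gamma_real_pos[of "x + 1/2"] by (simp add: ln_le_cancel_iff)
qed

text \<open>The half-step inequality for Gamma is used twice: at \<nu>/2 it bounds the Gamma
  quotient above by sqrt(\<nu>/2), and at (\<nu> - 1)/2, with the functional equation, below by
  sqrt((\<nu> - 1)/2).\<close>

lemma t_density_0_tendsto: "(\<lambda>\<nu>. t_density \<nu> 0) \<longlonglongrightarrow> 1 / sqrt (2 * pi)"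
proof (rule tendsto_sandwich)
  have d: "t_density \<nu> 0 = Gamma (real \<nu> / 2 + 1 / 2) / (sqrt (real \<nu> * pi) * Gamma (real \<nu> / 2))" for \<nu>
    by (simp add: t_density_def add_divide_distrib)
  show "\<forall>\<^sub>F \<nu> in sequentially. t_density \<nu> 0 \<le> 1 / sqrt (2 * pi)"
    using eventually_gt_at_top[of 0]
  proof eventually_elim
    case (elim \<nu>)
    then have "Gamma (real \<nu> / 2 + 1 / 2) / (sqrt (real \<nu> * pi) * Gamma (real \<nu> / 2))
        \<le> sqrt (real \<nu> / 2) * Gamma (real \<nu> / 2) / (sqrt (real \<nu> * pi) * Gamma (real \<nu> / 2))"
      by (intro divide_right_mono Gamma_half_le) (auto simp: Gamma_real_nonneg)
    also have "\<dots> = 1 / sqrt (2 * pi)"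
      using elim less_imp_neq[OF Gamma_real_pos[of "real \<nu> / 2"]] by (simp add: real_sqrt_divide real_sqrt_mult field_simps)
    finally show ?case by (simp add: d)
  qed
  show "\<forall>\<^sub>F \<nu> in sequentially. sqrt ((real \<nu> - 1) / 2) / sqrt (real \<nu> * pi) \<le> t_density \<nu> 0"
    using eventually_gt_at_top[of 1]
  proof eventually_elim
    case (elim \<nu>)
    define y where "y = (real \<nu> - 1) / 2"
    have y: "0 < y" "real \<nu> / 2 = y + 1 / 2" using elim by (auto simp: y_def field_simps)
    have "Gamma (y + 1) = y * Gamma y" using y by (intro Gamma_plus1) (auto elim!: nonpos_Ints_cases)
    then have "Gamma (real \<nu> / 2 + 1 / 2) = sqrt y * (sqrt y * Gamma y)"
      unfolding y(2) using y(1) by (simp add: add.assoc)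
    moreover have "sqrt y * Gamma (real \<nu> / 2) \<le> sqrt y * (sqrt y * Gamma y)"
      unfolding y(2) using y(1) by (intro mult_left_mono Gamma_half_le) auto
    ultimately have "sqrt y * Gamma (real \<nu> / 2) \<le> Gamma (real \<nu> / 2 + 1 / 2)" by (simp only:)
    then have "sqrt y * Gamma (real \<nu> / 2) / (sqrt (real \<nu> * pi) * Gamma (real \<nu> / 2)) \<le> t_density \<nu> 0"
      unfolding d using elim by (intro divide_right_mono mult_nonneg_nonneg Gamma_real_nonneg) auto
    then show ?case using elim less_imp_neq[OF Gamma_real_pos[of "real \<nu> / 2"]] by (simp add: y_def)
  qed
  show "(\<lambda>\<nu>. sqrt ((real \<nu> - 1) / 2) / sqrt (real \<nu> * pi)) \<longlonglongrightarrow> 1 / sqrt (2 * pi)"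
    by real_asymp (simp add: powr_half_sqrt real_sqrt_divide real_sqrt_mult field_simps)
qed simp

text \<open>The t-analogue of the upper Mills bound: the right-hand side is the integral of (x/c)
  times the density over x \<ge> c, which is elementary and finite since \<nu> > 1.\<close>

lemma t_tail_upper_bound:
  assumes "2 \<le> \<nu>" "0 < c"
  shows "1 - F_t \<nu> c \<le> t_density \<nu> 0 * (real \<nu> / (real \<nu> - 1)) * (1 + c\<^sup>2 / real \<nu>) powr (- (real \<nu> - 1) / 2) / c"
proof -
  interpret t: even_density "t_density \<nu>" by (rule even_density_t) (use assms in simp)
  define K where "K = t_density \<nu> 0 * (real \<nu> / (real \<nu> - 1))"
  have v: "1 < real \<nu>" using assms by simp
  have K: "0 < K" using v t_density_0_pos[of \<nu>] assms by (simp add: K_def)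
  define r where "r x = K * (1 + x\<^sup>2 / real \<nu>) powr (- (real \<nu> - 1) / 2) / x" for x
  have "0 \<le> r c - (1 - F_t \<nu> c)"
  proof (rule nonneg_of_DERIV_le_0_tendsto_0[where g = "\<lambda>x. r x - (1 - F_t \<nu> x)"])
    fix x assume "c \<le> x"
    then have x: "0 < x" using assms by simp
    have q: "0 < 1 + x\<^sup>2 / real \<nu>" using v by (simp add: add_pos_nonneg)
    let ?e = "- (real \<nu> - 1) / 2"
    have "((\<lambda>x. (1 + x\<^sup>2 / real \<nu>) powr ?e) has_real_derivative
        ?e * (1 + x\<^sup>2 / real \<nu>) powr (?e - 1) * (2 * x / real \<nu>)) (at x)"
      using q v by (auto intro!: derivative_eq_intros)
    then have "(r has_real_derivative (K * (?e * (1 + x\<^sup>2 / real \<nu>) powr (?e - 1) * (2 * x / real \<nu>)) * x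
        - K * (1 + x\<^sup>2 / real \<nu>) powr ?e * 1) / (x * x)) (at x)"
      unfolding r_def using x by (intro DERIV_divide DERIV_cmult DERIV_ident) auto
    then have "((\<lambda>x. r x - (1 - F_t \<nu> x)) has_real_derivative (K * (?e * (1 + x\<^sup>2 / real \<nu>) powr (?e - 1) * (2 * x / real \<nu>)) * x
        - K * (1 + x\<^sup>2 / real \<nu>) powr ?e * 1) / (x * x) - (0 - t_density \<nu> x)) (at x)"
      unfolding F_t_def by (intro DERIV_diff DERIV_const t.DERIV_cdf)
    moreover have "(K * (?e * (1 + x\<^sup>2 / real \<nu>) powr (?e - 1) * (2 * x / real \<nu>)) * x
        - K * (1 + x\<^sup>2 / real \<nu>) powr ?e * 1) / (x * x) - (0 - t_density \<nu> x) \<le> 0"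
    proof -
      have e: "?e - 1 = - (real \<nu> + 1) / 2" by (simp add: field_simps)
      have k: "K * ?e * 2 / real \<nu> = - t_density \<nu> 0" using v by (simp add: K_def field_simps)
      \<comment> \<open>Divided by \<open>x * x\<close>, this term is exactly minus the t-density
        and cancels the derivative of the tail; what remains has the sign of -K.\<close>
      have "K * (?e * (1 + x\<^sup>2 / real \<nu>) powr (?e - 1) * (2 * x / real \<nu>)) * x
          = K * ?e * 2 / real \<nu> * (1 + x\<^sup>2 / real \<nu>) powr (?e - 1) * (x * x)" by (simp add: field_simps)
      also have "\<dots> = - t_density \<nu> x * (x * x)"
        unfolding k e by (subst t_density_eq_powr[of \<nu> x]) simp
      finally show ?thesis using x K by (simp add: field_simps)
    qed
    ultimately show "\<exists>y. ((\<lambda>x. r x - (1 - F_t \<nu> x)) has_real_derivative y) (at x) \<and> y \<le> 0" by blast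
  next
    have "(r \<longlongrightarrow> 0) at_top" unfolding r_def using v K by real_asymp
    then show "((\<lambda>x. r x - (1 - F_t \<nu> x)) \<longlongrightarrow> 0) at_top"
      using tendsto_diff[OF _ t.tail_at_top] unfolding F_t_def by fastforce
  qed
  then show ?thesis by (simp add: r_def K_def)
qed

text \<open>Since \<nu> S^2 has mean \<nu> and variance 2 \<nu>, this value of s^2 lies b standard
  deviations of S^2 below its mean: the window resolved by the central limit theorem.\<close>

definition crit_sq :: "real \<Rightarrow> real \<Rightarrow> real" where "crit_sq b v = 1 - b * sqrt (2 / v)"

text \<open>The stationary point in q = 1 + u^2/v of the log density quotient, whose derivative (v +
  1)/(2 q) - v s^2/2 vanishes here for s^2 = \<open>crit_sq b v\<close>.\<close>

definition crit_w :: "real \<Rightarrow> real \<Rightarrow> real" where "crit_w b v = (v + 1) / (v * crit_sq b v)"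

text \<open>The value of (v + 1)/2 ln(1 + u^2/v) - s^2 u^2/2 at the stationary point. It equals (v +
  1)/2 (ln w - 1 + 1/w), which is of second order in w - 1; this is why a finite limit b^2/2
  emerges.\<close>

definition crit_max :: "real \<Rightarrow> real \<Rightarrow> real" where
  "crit_max b v = (v + 1) / 2 * (ln (crit_w b v) - 1) + v * crit_sq b v / 2"

lemma crit_tendsto:
  assumes "0 < b"
  shows "(crit_sq b \<longlongrightarrow> 1) at_top" "(crit_w b \<longlongrightarrow> 1) at_top" "(crit_max b \<longlongrightarrow> b\<^sup>2 / 2) at_top"
proof -
  show "(crit_sq b \<longlongrightarrow> 1) at_top" "(crit_w b \<longlongrightarrow> 1) at_top"
    unfolding crit_w_def crit_sq_def using assms by real_asymp+
  have "2 powr (1 / 2) * 2 powr (1 / 2) = (2 :: real)" by (simp add: powr_add[symmetric])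
  then show "(crit_max b \<longlongrightarrow> b\<^sup>2 / 2) at_top"
    unfolding crit_max_def crit_w_def crit_sq_def using assms
    by real_asymp (simp add: power2_eq_square field_simps)
qed

lemma eventually_crit_sq_pos:
  assumes "0 < b" shows "\<forall>\<^sub>F \<nu> in sequentially. 0 < crit_sq b (real \<nu>)"
  by (rule order_tendstoD(1)[OF filterlim_compose[OF crit_tendsto(1)[OF assms] filterlim_real_sequentially]]) simp

text \<open>The quotient of the normal density of scale $1/s$ and the $t$-density is largest where
  $1 + u^2/\nu = w$; the tangent line of the logarithm at $w$ gives the bound for all $u$.\<close>

lemma normal_density_le_t_density:
  assumes \<nu>: "1 \<le> \<nu>" and sq: "0 < crit_sq b (real \<nu>)" and s: "s = sqrt (crit_sq b (real \<nu>))" and \<alpha>: "0 \<le> \<alpha>"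
    and le: "\<alpha> * s * exp (crit_max b (real \<nu>)) / sqrt (2 * pi) \<le> t_density \<nu> 0"
  shows "\<alpha> * s * std_normal_density (s * u) \<le> t_density \<nu> u"
proof -
  define v where "v = real \<nu>"
  define w where "w = crit_w b v"
  define q where "q = 1 + u\<^sup>2 / v"
  have v: "0 < v" using \<nu> by (simp add: v_def)
  have sq': "0 < crit_sq b v" "s\<^sup>2 = crit_sq b v" "0 < s" using sq s by (auto simp: v_def)
  have w: "0 < w" "(v + 1) / w = v * s\<^sup>2" using v sq' by (auto simp: w_def crit_w_def)
  have q: "0 < q" using v by (simp add: q_def add_pos_nonneg)
  have "ln (q / w) \<le> q / w - 1" using q w by (intro ln_le_minus_one) simp
  then have "ln q \<le> ln w + q / w - 1" using q w by (simp add: ln_div)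
  then have "(v + 1) / 2 * ln q \<le> (v + 1) / 2 * (ln w + q / w - 1)"
    using v by (intro mult_left_mono) auto
  also have "\<dots> = (v + 1) / 2 * (ln w - 1) + (v + 1) / w * q / 2" using w(1) by (simp add: field_simps)
  also have "\<dots> = crit_max b v + s\<^sup>2 * u\<^sup>2 / 2"
    unfolding w(2) using v by (simp add: crit_max_def w_def q_def sq' field_simps)
  finally have "- ((s * u)\<^sup>2 / 2) \<le> crit_max b v + - ((v + 1) / 2) * ln q" by (simp add: power_mult_distrib)
  then have "exp (- ((s * u)\<^sup>2 / 2)) \<le> exp (crit_max b v + - ((v + 1) / 2) * ln q)" by (simp only: exp_le_cancel_iff)
  also have "\<dots> = exp (crit_max b v) * q powr (- (v + 1) / 2)"
    unfolding exp_add using q by (simp add: powr_def algebra_simps)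
  finally have "exp (- ((s * u)\<^sup>2 / 2)) \<le> exp (crit_max b v) * q powr (- (v + 1) / 2)" .
  then have "\<alpha> * s / sqrt (2 * pi) * exp (- ((s * u)\<^sup>2 / 2)) \<le> \<alpha> * s / sqrt (2 * pi) * (exp (crit_max b v) * q powr (- (v + 1) / 2))"
    using \<alpha> sq' by (intro mult_left_mono) auto
  also have "\<dots> = \<alpha> * s * exp (crit_max b v) / sqrt (2 * pi) * q powr (- (v + 1) / 2)" by simp
  also have "\<dots> \<le> t_density \<nu> 0 * q powr (- (v + 1) / 2)"
    using le by (intro mult_right_mono) (auto simp: v_def)
  also have "\<dots> = t_density \<nu> u" by (subst t_density_eq_powr[of \<nu> u]) (simp add: q_def v_def)
  finally show ?thesis by (simp add: std_normal_density_def)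
qed

text \<open>Because \<alpha> exp(b^2/2) < 1, the density \<alpha> s phi(s u) eventually lies below
  the t-density for all u, and integrating from infinity compares the tails at c \<ge> 0. For c < 0
  the t-tail exceeds 1/2 \<ge> \<alpha>.\<close>

lemma eventually_no_crossing:
  assumes \<alpha>: "0 < \<alpha>" "\<alpha> \<le> 1 / 2" and b: "0 < b" "b < sqrt (- 2 * ln \<alpha>)"
  shows "\<forall>\<^sub>F \<nu> in sequentially. \<forall>c. \<alpha> * Phi (- (sqrt (crit_sq b (real \<nu>)) * c)) \<le> 1 - F_t \<nu> c"
proof -
  have "b\<^sup>2 < (sqrt (- 2 * ln \<alpha>))\<^sup>2" using b by (intro power_strict_mono) auto
  also have "\<dots> = - 2 * ln \<alpha>" using \<alpha> by (simp add: ln_le_zero_iff)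
  finally have "b\<^sup>2 / 2 < - ln \<alpha>" by simp
  then have "exp (b\<^sup>2 / 2) < exp (- ln \<alpha>)" by (simp only: exp_less_mono)
  then have "\<alpha> * sqrt 1 * exp (b\<^sup>2 / 2) / sqrt (2 * pi) < 1 / sqrt (2 * pi)"
    using \<alpha> by (intro divide_strict_right_mono) (auto simp: exp_minus field_simps)
  moreover have "(\<lambda>\<nu>. \<alpha> * sqrt (crit_sq b (real \<nu>)) * exp (crit_max b (real \<nu>)) / sqrt (2 * pi) - t_density \<nu> 0)
      \<longlonglongrightarrow> \<alpha> * sqrt 1 * exp (b\<^sup>2 / 2) / sqrt (2 * pi) - 1 / sqrt (2 * pi)"
    by (intro tendsto_intros t_density_0_tendsto filterlim_compose[OF crit_tendsto(1)[OF b(1)] filterlim_real_sequentially]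
        filterlim_compose[OF crit_tendsto(3)[OF b(1)] filterlim_real_sequentially]) auto
  ultimately have "\<forall>\<^sub>F \<nu> in sequentially. \<alpha> * sqrt (crit_sq b (real \<nu>)) * exp (crit_max b (real \<nu>)) / sqrt (2 * pi) - t_density \<nu> 0 < 0"
    by (intro order_tendstoD(2)) auto
  then show ?thesis using eventually_crit_sq_pos[OF b(1)] eventually_ge_at_top[of 1]
  proof eventually_elim
    case (elim \<nu>)
    define s where "s = sqrt (crit_sq b (real \<nu>))"
    have s: "0 < s" using elim by (simp add: s_def)
    interpret t: even_density "t_density \<nu>" by (rule even_density_t) (use elim in simp)
    have dens: "\<alpha> * s * std_normal_density (s * u) \<le> t_density \<nu> u" for u
      by (rule normal_density_le_t_density) (use elim \<alpha> in \<open>auto simp: s_def\<close>)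
    have "\<alpha> * Phi (- (s * c)) \<le> 1 - F_t \<nu> c" for c
    proof (cases "c < 0")
      case True
      have "\<alpha> * Phi (- (s * c)) \<le> \<alpha> * 1" using \<alpha> Phi_less_1 by (intro mult_left_mono) (auto simp: less_imp_le)
      moreover have "F_t \<nu> c < F_t \<nu> 0" using t.cdf_strict_mono[OF True] by (simp add: F_t_def)
      moreover have "F_t \<nu> 0 = 1 / 2" unfolding F_t_def by (rule t.cdf_0)
      ultimately show ?thesis using \<alpha> by linarith
    next
      case False
      let ?g = "\<lambda>x. (1 - F_t \<nu> x) - \<alpha> * (1 - Phi (s * x))"
      have "0 \<le> ?g c"
      proof (rule nonneg_of_DERIV_le_0_tendsto_0[where g = ?g])
        fix x
        have "((\<lambda>x. Phi (s * x)) has_real_derivative std_normal_density (s * x) * s) (at x)"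
          by (rule DERIV_chain2[OF DERIV_Phi]) (auto intro!: derivative_eq_intros)
        then have "(?g has_real_derivative (0 - t_density \<nu> x) - \<alpha> * (0 - std_normal_density (s * x) * s)) (at x)"
          unfolding F_t_def by (intro DERIV_diff DERIV_cmult DERIV_const t.DERIV_cdf)
        then show "\<exists>y. (?g has_real_derivative y) (at x) \<and> y \<le> 0"
          using dens[of x] by (auto simp: algebra_simps)
      next
        have "((\<lambda>x. Phi (s * x)) \<longlongrightarrow> 1) at_top"
          by (rule filterlim_compose[OF Phi_at_top]) (use s in real_asymp)
        then have "(?g \<longlongrightarrow> 0 - \<alpha> * (1 - 1)) at_top"
          using t.tail_at_top unfolding F_t_def by (intro tendsto_intros)
        then show "(?g \<longlongrightarrow> 0) at_top" by simp
      qed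
      then show ?thesis by (simp add: Phi_minus)
    qed
    then show ?case by (simp add: s_def)
  qed
qed

text \<open>The tails are compared at one point, the peak of the density quotient. The upper t-bound
  and the lower Mills bound share the factor phi(s c)/c there, and all other factors converge, so
  the claim reduces to exp(-b^2/2) < \<alpha>.\<close>

lemma eventually_crossing:
  assumes \<alpha>: "0 < \<alpha>" "\<alpha> \<le> 1 / 2" and b: "sqrt (- 2 * ln \<alpha>) < b"
  shows "\<forall>\<^sub>F \<nu> in sequentially. \<exists>c. 1 - F_t \<nu> c < \<alpha> * Phi (- (sqrt (crit_sq b (real \<nu>)) * c))"
proof -
  have "0 \<le> sqrt (- 2 * ln \<alpha>)" using \<alpha> by (simp add: ln_le_zero_iff)
  then have b0: "0 < b" using b by linarith
  have "(sqrt (- 2 * ln \<alpha>))\<^sup>2 < b\<^sup>2" using b \<alpha> by (intro power_strict_mono) (auto simp: ln_le_zero_iff)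
  also have "(sqrt (- 2 * ln \<alpha>))\<^sup>2 = - 2 * ln \<alpha>" using \<alpha> by (simp add: ln_le_zero_iff)
  finally have "- (b\<^sup>2 / 2) < ln \<alpha>" by simp
  then have "exp (- (b\<^sup>2 / 2)) < exp (ln \<alpha>)" by (simp only: exp_less_mono)
  then have lim_less: "sqrt (2 * pi) * (1 / sqrt (2 * pi)) * 1 * 1 * exp (- (b\<^sup>2 / 2)) < \<alpha> * (1 / sqrt 1) * (1 - 0)" using \<alpha> by simp
  have ratio: "(\<lambda>\<nu>. real \<nu> / (real \<nu> - 1)) \<longlonglongrightarrow> 1" by real_asymp
  \<comment> \<open>The denominator is (s c)^2 at the peak and equals 1 + b sqrt(2 \<nu>); the
    quotient is the relative error in Mills' bound.\<close>
  have inv: "(\<lambda>\<nu>. 1 / (real \<nu> + 1 - real \<nu> * crit_sq b (real \<nu>))) \<longlonglongrightarrow> 0"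
    unfolding crit_sq_def using b0 by real_asymp
  note lims = filterlim_compose[OF crit_tendsto(1)[OF b0] filterlim_real_sequentially]
    filterlim_compose[OF crit_tendsto(2)[OF b0] filterlim_real_sequentially]
    filterlim_compose[OF crit_tendsto(3)[OF b0] filterlim_real_sequentially]
  have "(\<lambda>\<nu>. \<alpha> * (1 / sqrt (crit_sq b (real \<nu>))) * (1 - 1 / (real \<nu> + 1 - real \<nu> * crit_sq b (real \<nu>)))
      - sqrt (2 * pi) * t_density \<nu> 0 * (real \<nu> / (real \<nu> - 1)) * crit_w b (real \<nu>) * exp (- crit_max b (real \<nu>)))
      \<longlonglongrightarrow> \<alpha> * (1 / sqrt 1) * (1 - 0) - sqrt (2 * pi) * (1 / sqrt (2 * pi)) * 1 * 1 * exp (- (b\<^sup>2 / 2))"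
    by (intro tendsto_intros t_density_0_tendsto ratio inv lims) auto
  from order_tendstoD(1)[OF this, of 0]
  have "\<forall>\<^sub>F \<nu> in sequentially. 0 < \<alpha> * (1 / sqrt (crit_sq b (real \<nu>))) * (1 - 1 / (real \<nu> + 1 - real \<nu> * crit_sq b (real \<nu>)))
      - sqrt (2 * pi) * t_density \<nu> 0 * (real \<nu> / (real \<nu> - 1)) * crit_w b (real \<nu>) * exp (- crit_max b (real \<nu>))"
    using lim_less by simp
  then show ?thesis using eventually_crit_sq_pos[OF b0] eventually_ge_at_top[of 2]
  proof eventually_elim
    case (elim \<nu>)
    define v where "v = real \<nu>"
    define s where "s = sqrt (crit_sq b v)"
    define w where "w = crit_w b v"
    \<comment> \<open>The peak of the density quotient: 1 + c^2/v = w.\<close>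
    define c where "c = sqrt (v * (w - 1))"
    have v: "2 \<le> v" using elim by (simp add: v_def)
    have sq: "0 < crit_sq b v" "s\<^sup>2 = crit_sq b v" "0 < s" using elim by (auto simp: s_def v_def)
    have "crit_sq b v < 1" using b0 v by (simp add: crit_sq_def)
    then have "v * crit_sq b v < v * 1" using v by (intro mult_strict_left_mono) auto
    then have "v * crit_sq b v < v + 1" by simp
    then have w: "1 < w" using v sq by (simp add: w_def crit_w_def)
    have c: "0 < c" "c\<^sup>2 = v * (w - 1)" "1 + c\<^sup>2 / v = w" using w v by (auto simp: c_def)
    have sc2: "(s * c)\<^sup>2 = v + 1 - v * crit_sq b v"
      unfolding power_mult_distrib c(2) sq(2) using v sq by (simp add: w_def crit_w_def field_simps)
    have sc: "0 < s * c" using sq c by simp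
    have "1 - F_t \<nu> c \<le> t_density \<nu> 0 * (v / (v - 1)) * w powr (- (v - 1) / 2) / c"
      using t_tail_upper_bound[OF elim(3) c(1)] c(3) by (simp add: v_def)
    also have "w powr (- (v - 1) / 2) = w * w powr (- (v + 1) / 2)"
      using w by (subst powr_mult_base) (auto simp: field_simps)
    \<comment> \<open>The identity \<open>crit_max b v\<close> = (v + 1)/2 ln w - (s c)^2/2 trades
      the t-density at the peak for the normal one.\<close>
    also have "w powr (- (v + 1) / 2) = exp (- crit_max b v) * exp (- (s * c)\<^sup>2 / 2)"
    proof -
      have "- (v + 1) / 2 * ln w = - crit_max b v + - (s * c)\<^sup>2 / 2"
        unfolding sc2 by (simp add: crit_max_def w_def field_simps)
      then show ?thesis using w by (simp only: powr_def exp_add) simp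
    qed
    also have "t_density \<nu> 0 * (v / (v - 1)) * (w * (exp (- crit_max b v) * exp (- (s * c)\<^sup>2 / 2))) / c
        = sqrt (2 * pi) * t_density \<nu> 0 * (v / (v - 1)) * w * exp (- crit_max b v) * (std_normal_density (s * c) / c)"
      by (simp add: std_normal_density_def)
    also have "\<dots> < \<alpha> * (1 / s) * (1 - 1 / (s * c)\<^sup>2) * (std_normal_density (s * c) / c)"
    proof (rule mult_strict_right_mono)
      show "sqrt (2 * pi) * t_density \<nu> 0 * (v / (v - 1)) * w * exp (- crit_max b v) < \<alpha> * (1 / s) * (1 - 1 / (s * c)\<^sup>2)"
        using elim(1) unfolding sc2 by (simp add: v_def s_def w_def)
      show "0 < std_normal_density (s * c) / c" using c by (simp add: normal_density_pos)
    qed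
    also have "\<dots> = \<alpha> * (std_normal_density (s * c) * (1 / (s * c) - 1 / (s * c) ^ 3))"
      using sq c by (simp add: field_simps power2_eq_square power3_eq_cube)
    also have "\<dots> \<le> \<alpha> * Phi (- (s * c))"
      using \<alpha> Mills_lower_bound[OF sc] by (intro mult_left_mono) auto
    finally show ?case by (auto simp: s_def v_def)
  qed
qed

section \<open>The distribution of S\<close>

abbreviation PZ :: "nat \<Rightarrow> (nat \<Rightarrow> real) measure" where "PZ \<nu> \<equiv> PiM {..<\<nu>} (\<lambda>_. std_normal)"

lemma prob_space_PZ: "prob_space (PZ \<nu>)"
  by (intro prob_space_PiM) simp

lemma S_stat_measurable [measurable]: "S_stat \<nu> \<in> borel_measurable (PZ \<nu>)"
  unfolding S_stat_def[abs_def] by measurable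

lemma std_normal_even_moment:
  "integrable std_normal (\<lambda>x. x ^ (2 * k))"
  "(\<integral>x. x ^ (2 * k) \<partial>std_normal) = fact (2 * k) / (2 ^ k * fact k)"
proof -
  note m = std_normal_moment_even[of k]
  show "integrable std_normal (\<lambda>x. x ^ (2 * k))"
    unfolding std_normal_def using m by (subst integrable_density) (auto simp: has_bochner_integral_iff)
  show "(\<integral>x. x ^ (2 * k) \<partial>std_normal) = fact (2 * k) / (2 ^ k * fact k)"
    unfolding std_normal_def using m by (subst integral_density) (auto simp: has_bochner_integral_iff)
qed

text \<open>The central limit theorem concerns one infinite sequence, so it is applied on the
  infinite product and transferred to the finite ones. The variance of Z^2 is 3 - 1 = 2 by the even
  moments.\<close>

lemma chi_square_CLT:
  "(\<lambda>\<nu>. measure (PZ \<nu>) {z\<in>space (PZ \<nu>). (\<Sum>j<\<nu>. (z j)\<^sup>2 - 1) / sqrt (real \<nu> * 2) \<le> y}) \<longlonglongrightarrow> Phi y"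
proof -
  let ?U = "PiM UNIV (\<lambda>_::nat. std_normal)"
  interpret prob_space ?U by (rule prob_space_PiM) simp
  interpret P: product_prob_space "\<lambda>_::nat. std_normal" UNIV
    by (intro product_prob_spaceI) simp
  let ?h = "\<lambda>x::real. x\<^sup>2 - 1"
  have sq: "integrable std_normal (\<lambda>x. x\<^sup>2)" "(\<integral>x. x\<^sup>2 \<partial>std_normal) = 1"
    using std_normal_even_moment[of 1] by (simp_all add: fact_numeral)
  have four: "integrable std_normal (\<lambda>x. x ^ 4)" "(\<integral>x. x ^ 4 \<partial>std_normal) = 3"
    using std_normal_even_moment[of 2] by (simp_all add: fact_numeral)
  note total = prob_space.prob_space[OF prob_space_std_normal, unfolded space_std_normal]
  have h2: "(?h x)\<^sup>2 = x ^ 4 - 2 * x\<^sup>2 + 1" for x by (simp add: power2_eq_square power4_eq_xxxx algebra_simps)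
  have h: "integrable std_normal ?h" "(\<integral>x. ?h x \<partial>std_normal) = 0"
    using sq by (auto simp: total)
  have hh: "integrable std_normal (\<lambda>x. (?h x)\<^sup>2)" "(\<integral>x. (?h x)\<^sup>2 \<partial>std_normal) = 2"
    unfolding h2 using sq four by (auto simp: total)
  have mean: "expectation (\<lambda>z. ?h (z n)) = 0" for n
    using integral_PiM_component(2)[OF prob_space_std_normal UNIV_I h(1)] h(2) by simp
  have "weak_conv_m (\<lambda>n. distr ?U borel (\<lambda>z. (\<Sum>j<n. ?h (z j)) / sqrt (real n * (sqrt 2)\<^sup>2))) std_normal_distribution"
  proof (rule central_limit_theorem_zero_mean)
    show "indep_vars (\<lambda>i. borel) (\<lambda>i z. ?h (z i)) UNIV"
      by (rule indep_vars_compose2[OF indep_vars_PiM_components]) auto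
    show "expectation (\<lambda>z. ?h (z n)) = 0" for n by (rule mean)
    show "integrable ?U (\<lambda>z. (?h (z n))\<^sup>2)" for n
      by (rule integral_PiM_component(1)[OF prob_space_std_normal UNIV_I hh(1)])
    show "variance (\<lambda>z. ?h (z n)) = (sqrt 2)\<^sup>2" for n
      using integral_PiM_component(2)[OF prob_space_std_normal UNIV_I hh(1)] hh(2) by (simp only: mean) simp
    show "distr ?U borel (\<lambda>z. ?h (z n)) = distr std_normal borel ?h" for n
    proof -
      have "distr ?U borel (\<lambda>z. ?h (z n)) = distr (distr ?U std_normal (\<lambda>z. z n)) borel ?h"
        by (subst distr_distr) (auto simp: comp_def)
      also have "distr ?U std_normal (\<lambda>z. z n) = std_normal" by (intro distr_PiM_component) auto
      finally show ?thesis .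
    qed
  qed simp
  then have "(\<lambda>n. cdf (distr ?U borel (\<lambda>z. (\<Sum>j<n. ?h (z j)) / sqrt (real n * 2))) y) \<longlonglongrightarrow> Phi y"
    using isCont_Phi by (simp add: weak_conv_m_def weak_conv_def Phi_eq)
  moreover have "cdf (distr ?U borel (\<lambda>z. (\<Sum>j<n. ?h (z j)) / sqrt (real n * 2))) y
      = measure (PZ n) {z\<in>space (PZ n). (\<Sum>j<n. (z j)\<^sup>2 - 1) / sqrt (real n * 2) \<le> y}" for n
  proof -
    let ?f = "\<lambda>z::nat \<Rightarrow> real. (\<Sum>j<n. ?h (z j)) / sqrt (real n * 2)"
    have m1 [measurable]: "?f \<in> borel_measurable (PZ n)" by measurable
    have m2: "(\<lambda>z. restrict z {..<n}) \<in> measurable ?U (PZ n)" by measurable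
    \<comment> \<open>The partial sum depends only on the first \<open>n\<close> coordinates, whose
      joint law is the finite product.\<close>
    have "distr ?U borel ?f = distr ?U borel (?f \<circ> (\<lambda>z. restrict z {..<n}))"
      by (intro distr_cong) auto
    also have "\<dots> = distr (distr ?U (PZ n) (\<lambda>z. restrict z {..<n})) borel ?f"
      using m1 m2 by (rule distr_distr[symmetric])
    also have "distr ?U (PZ n) (\<lambda>z. restrict z {..<n}) = PZ n"
      by (rule P.distr_PiM_restrict_finite) auto
    finally have "cdf (distr ?U borel ?f) y = measure (PZ n) (?f -` {..y} \<inter> space (PZ n))"
      by (simp add: cdf_def2 measure_distr[OF m1])
    also have "?f -` {..y} \<inter> space (PZ n) = {z\<in>space (PZ n). (\<Sum>j<n. (z j)\<^sup>2 - 1) / sqrt (real n * 2) \<le> y}" by auto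
    finally show ?thesis .
  qed
  ultimately show ?thesis by simp
qed

lemma S_stat_crit_tendsto:
  "(\<lambda>\<nu>. measure (PZ \<nu>) {z\<in>space (PZ \<nu>). S_stat \<nu> z \<le> sqrt (crit_sq b (real \<nu>))}) \<longlonglongrightarrow> Phi (- b)"
proof (rule Lim_transform_eventually[OF chi_square_CLT[of "- b"]], use eventually_gt_at_top[of 0] in eventually_elim)
  case (elim \<nu>)
  have "(\<Sum>j<\<nu>. (z j)\<^sup>2 - 1) / sqrt (real \<nu> * 2) \<le> - b \<longleftrightarrow> S_stat \<nu> z \<le> sqrt (crit_sq b (real \<nu>))" for z
  proof -
    have "S_stat \<nu> z \<le> sqrt (crit_sq b (real \<nu>)) \<longleftrightarrow> (\<Sum>j<\<nu>. (z j)\<^sup>2) \<le> real \<nu> * crit_sq b (real \<nu>)"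
      using elim by (simp add: S_stat_def field_simps)
    also have "real \<nu> * crit_sq b (real \<nu>) = real \<nu> - b * sqrt (real \<nu> * 2)"
    proof -
      have "real \<nu> * sqrt (2 / real \<nu>) = sqrt (real \<nu> * 2)"
        using elim by (simp add: real_sqrt_divide real_sqrt_mult real_div_sqrt field_simps)
      then show ?thesis by (simp add: crit_sq_def algebra_simps)
    qed
    also have "(\<Sum>j<\<nu>. (z j)\<^sup>2) \<le> real \<nu> - b * sqrt (real \<nu> * 2) \<longleftrightarrow> (\<Sum>j<\<nu>. (z j)\<^sup>2 - 1) \<le> - b * sqrt (real \<nu> * 2)"
      by (simp add: sum_subtractf algebra_simps)
    also have "\<dots> \<longleftrightarrow> (\<Sum>j<\<nu>. (z j)\<^sup>2 - 1) / sqrt (real \<nu> * 2) \<le> - b"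
      using elim by (simp add: pos_divide_le_eq)
    finally show ?thesis by simp
  qed
  then show ?case by simp
qed

text \<open>By Tonelli's theorem the last coordinate is integrated first: with the others fixed, S =
  s determines its square and leaves at most two values, a null set.\<close>

lemma AE_S_stat_neq:
  assumes "1 \<le> \<nu>"
  shows "AE z in PZ \<nu>. S_stat \<nu> z \<noteq> s"
proof -
  interpret P: product_prob_space "\<lambda>_::nat. std_normal" UNIV
    by (intro product_prob_spaceI) simp
  obtain k where k: "\<nu> = Suc k" using assms by (cases \<nu>) auto
  have "emeasure (PZ \<nu>) {z\<in>space (PZ \<nu>). S_stat \<nu> z = s} = (\<integral>\<^sup>+z. indicator {z\<in>space (PZ \<nu>). S_stat \<nu> z = s} z \<partial>PZ \<nu>)"
    by (rule nn_integral_indicator[symmetric]) measurable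
  also have "\<dots> = (\<integral>\<^sup>+x. (\<integral>\<^sup>+y. indicator {z\<in>space (PZ \<nu>). S_stat \<nu> z = s} (x(k := y)) \<partial>std_normal) \<partial>PZ k)"
    unfolding k lessThan_Suc
    by (rule P.product_nn_integral_insert) (simp_all add: lessThan_Suc[symmetric], measurable)
  also have "\<dots> \<le> (\<integral>\<^sup>+x. 0 \<partial>PZ k)"
  proof (rule nn_integral_mono)
    fix x :: "nat \<Rightarrow> real"
    define c where "c = real \<nu> * s\<^sup>2 - (\<Sum>j<k. (x j)\<^sup>2)"
    have "y \<in> {sqrt c, - sqrt c}" if "S_stat \<nu> (x(k := y)) = s" for y
    proof -
      have "(S_stat \<nu> (x(k := y)))\<^sup>2 = ((\<Sum>j<k. (x j)\<^sup>2) + y\<^sup>2) / real \<nu>"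
        unfolding S_stat_def k by (subst real_sqrt_pow2) (auto intro!: divide_nonneg_nonneg add_nonneg_nonneg sum_nonneg)
      then have "y\<^sup>2 = c" using that by (simp add: c_def k field_simps)
      then have "sqrt c = \<bar>y\<bar>" by (metis real_sqrt_abs)
      then show ?thesis by auto
    qed
    then have "(\<integral>\<^sup>+y. indicator {z\<in>space (PZ \<nu>). S_stat \<nu> z = s} (x(k := y)) \<partial>std_normal)
        \<le> (\<integral>\<^sup>+y. indicator {sqrt c, - sqrt c} y \<partial>std_normal)"
      by (intro nn_integral_mono) (auto simp: indicator_def)
    also have "\<dots> = emeasure std_normal {sqrt c, - sqrt c}" by simp
    also have "\<dots> \<le> emeasure std_normal {sqrt c} + emeasure std_normal {- sqrt c}"
      using emeasure_subadditive[of "{sqrt c}" std_normal "{- sqrt c}"] by (simp add: insert_commute)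
    also have "\<dots> = 0"
      unfolding std_normal_def by (simp add: even_density.emeasure_singleton[OF even_density_std_normal])
    finally show "(\<integral>\<^sup>+y. indicator {z\<in>space (PZ \<nu>). S_stat \<nu> z = s} (x(k := y)) \<partial>std_normal) \<le> 0" .
  qed
  finally have "emeasure (PZ \<nu>) {z\<in>space (PZ \<nu>). S_stat \<nu> z = s} = 0" by simp
  then show ?thesis by (intro AE_I'[of "{z\<in>space (PZ \<nu>). S_stat \<nu> z = s}"]) (auto intro!: null_setsI)
qed

section \<open>The limiting false discovery rate\<close>

text \<open>An explicit version of the conditional expectation given S = s, legitimate by
  independence and Fubini's theorem. It is also defined at s = 0, where division gives 0; S has this
  value with probability 0.\<close>

definition conditional_FDR :: "real \<Rightarrow> nat \<Rightarrow> nat \<Rightarrow> nat \<Rightarrow> real \<Rightarrow> real" where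
  "conditional_FDR \<alpha> \<nu> n m s
    = (\<integral>x. FDP \<alpha> n m (\<lambda>i. if i < m then 1 - F_t \<nu> (x i / s) else 0) \<partial>PZ m)"

definition crossing :: "nat \<Rightarrow> real \<Rightarrow> real set" where
  "crossing \<nu> \<alpha> = {s. 0 < s \<and> (\<exists>c. 1 - F_t \<nu> c < \<alpha> * Phi (- (s * c)))}"

lemma F_t_measurable:
  assumes "1 \<le> \<nu>" shows "F_t \<nu> \<in> borel_measurable borel"
proof -
  interpret t: even_density "t_density \<nu>" by (rule even_density_t[OF assms])
  show ?thesis
    unfolding F_t_def[abs_def]
    by (intro borel_measurable_continuous_onI continuous_at_imp_continuous_on ballI t.isCont_cdf_density)
qed

lemma conditional_FDR_measurable:
  assumes "0 < \<alpha>" "m \<le> n" "1 \<le> \<nu>"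
  shows "(\<lambda>z. conditional_FDR \<alpha> \<nu> n m (S_stat \<nu> z)) \<in> borel_measurable (PZ \<nu>)"
proof -
  interpret prob_space "PZ m" by (rule prob_space_PZ)
  note [measurable] = F_t_measurable[OF assms(3)]
  have "(\<lambda>\<omega>. FDP \<alpha> n m (\<lambda>i. if i < m then 1 - F_t \<nu> (snd \<omega> i / S_stat \<nu> (fst \<omega>)) else 0)) \<in> borel_measurable (PZ \<nu> \<Otimes>\<^sub>M PZ m)"
  proof (rule measurable_FDP[OF assms(1,2)])
    fix i
    show "(\<lambda>\<omega>. if i < m then 1 - F_t \<nu> (snd \<omega> i / S_stat \<nu> (fst \<omega>)) else 0) \<in> borel_measurable (PZ \<nu> \<Otimes>\<^sub>M PZ m)"
    proof (cases "i < m")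
      case True
      then have "i \<in> {..<m}" by simp
      then show ?thesis using True by simp measurable
    qed simp
  qed
  then show ?thesis
    unfolding conditional_FDR_def by (intro borel_measurable_lebesgue_integral) (simp add: case_prod_beta')
qed

lemma FDR_DEXt_eq:
  assumes "0 < \<alpha>" "m \<le> n" "1 \<le> \<nu>"
  shows "FDR_DEXt \<alpha> n m \<nu> = (\<integral>z. conditional_FDR \<alpha> \<nu> n m (S_stat \<nu> z) \<partial>PZ \<nu>)"
proof -
  interpret X: prob_space "PZ m" by (rule prob_space_PZ)
  interpret Z: prob_space "PZ \<nu>" by (rule prob_space_PZ)
  interpret XZ: pair_prob_space "PZ m" "PZ \<nu>" ..
  note [measurable] = F_t_measurable[OF assms(3)]
  have meas: "(\<lambda>\<omega>. FDP \<alpha> n m (pvals m \<nu> \<omega>)) \<in> borel_measurable (PZ m \<Otimes>\<^sub>M PZ \<nu>)"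
  proof (rule measurable_FDP[OF assms(1,2)])
    fix i
    show "(\<lambda>\<omega>. pvals m \<nu> \<omega> i) \<in> borel_measurable (PZ m \<Otimes>\<^sub>M PZ \<nu>)"
    proof (cases "i < m")
      case True
      then have "i \<in> {..<m}" by simp
      then show ?thesis using True unfolding pvals_def by simp measurable
    qed (simp add: pvals_def)
  qed
  have "integrable (PZ m \<Otimes>\<^sub>M PZ \<nu>) (\<lambda>\<omega>. FDP \<alpha> n m (pvals m \<nu> \<omega>))"
    by (rule XZ.integrable_const_bound[where B = 1]) (use FDP_bounds meas in auto)
  then have "integrable (PZ m \<Otimes>\<^sub>M PZ \<nu>) (\<lambda>(x, z). FDP \<alpha> n m (pvals m \<nu> (x, z)))"
    by (simp add: case_prod_beta')
  from XZ.integral_snd[OF this]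
  have "(\<integral>\<omega>. FDP \<alpha> n m (pvals m \<nu> \<omega>) \<partial>(PZ m \<Otimes>\<^sub>M PZ \<nu>))
      = (\<integral>z. (\<integral>x. FDP \<alpha> n m (pvals m \<nu> (x, z)) \<partial>PZ m) \<partial>PZ \<nu>)"
    by (simp add: case_prod_beta')
  moreover have "FDR_DEXt \<alpha> n m \<nu> = (\<integral>\<omega>. FDP \<alpha> n m (pvals m \<nu> \<omega>) \<partial>(PZ m \<Otimes>\<^sub>M PZ \<nu>))"
    by (simp only: FDR_DEXt_def DEXt_space_def FDP_def Let_def)
  moreover have "pvals m \<nu> (x, z) = (\<lambda>i. if i < m then 1 - F_t \<nu> (x i / S_stat \<nu> z) else 0)" for x z
    by (simp add: pvals_def fun_eq_iff)
  ultimately show ?thesis by (simp only: conditional_FDR_def)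
qed

text \<open>For c \<le> 0 the t-tail is at least 1/2 \<ge> \<alpha>, a level that \<alpha> Phi never
  reaches. Positivity of \<open>c\<close> is what makes Phi(-s c) strictly decreasing in s.\<close>

lemma crossing_argument_pos:
  assumes "1 \<le> \<nu>" "0 < \<alpha>" "\<alpha> \<le> 1 / 2" "1 - F_t \<nu> c \<le> \<alpha> * Phi y"
  shows "0 < c"
proof (rule ccontr)
  interpret t: even_density "t_density \<nu>" by (rule even_density_t[OF assms(1)])
  assume "\<not> 0 < c"
  then have "F_t \<nu> c \<le> F_t \<nu> 0" using t.cdf_nondecreasing[of c 0] by (simp add: F_t_def)
  moreover have "F_t \<nu> 0 = 1 / 2" unfolding F_t_def by (rule t.cdf_0)
  moreover have "\<alpha> * Phi y < \<alpha> * 1" using Phi_less_1 assms(2) by (intro mult_strict_left_mono)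
  ultimately show False using assms(3,4) by linarith
qed

text \<open>Lowering the scale raises the normal tail at the same \<open>c\<close>, so that mere
  contact becomes a strict crossing. Monotonicity of the crossing set and uniqueness of the critical
  scale both follow.\<close>

lemma crossing_of_weak_crossing:
  assumes "1 \<le> \<nu>" "0 < \<alpha>" "\<alpha> \<le> 1 / 2" "0 < s" "s < s'" "1 - F_t \<nu> c \<le> \<alpha> * Phi (- (s' * c))"
  shows "s \<in> crossing \<nu> \<alpha>"
proof -
  have "0 < c" by (rule crossing_argument_pos[OF assms(1-3,6)])
  then have "\<alpha> * Phi (- (s' * c)) < \<alpha> * Phi (- (s * c))"
    using assms(2,5) by (intro mult_strict_left_mono Phi_strict_mono) auto
  then have "1 - F_t \<nu> c < \<alpha> * Phi (- (s * c))" using assms(6) by linarith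
  then show ?thesis using assms(4) by (auto simp: crossing_def)
qed

lemma crossing_downward:
  assumes "1 \<le> \<nu>" "0 < \<alpha>" "\<alpha> \<le> 1 / 2" "s' \<in> crossing \<nu> \<alpha>" "0 < s" "s \<le> s'"
  shows "s \<in> crossing \<nu> \<alpha>"
proof (cases "s = s'")
  case False
  obtain c where "1 - F_t \<nu> c < \<alpha> * Phi (- (s' * c))" using assms(4) by (auto simp: crossing_def)
  with False show ?thesis using crossing_of_weak_crossing[OF assms(1-3,5), of s' c] assms(6) by simp
qed (use assms in simp)

text \<open>Each \<open>c\<close> contributes an open set of scales because the inequality is
  strict; the union over uncountably many \<open>c\<close> is therefore harmless.\<close>

lemma crossing_borel: "crossing \<nu> \<alpha> \<in> sets borel"
proof -
  have "crossing \<nu> \<alpha> = {0<..} \<inter> (\<Union>c. {s. 1 - F_t \<nu> c < \<alpha> * Phi (- (s * c))})"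
    by (auto simp: crossing_def)
  moreover have "open {s. 1 - F_t \<nu> c < \<alpha> * Phi (- (s * c))}" for c
  proof (intro open_Collect_less continuous_intros)
    show "continuous_on UNIV (\<lambda>s. Phi (- (s * c)))"
      by (rule continuous_on_compose2[of UNIV Phi]) (auto intro!: continuous_intros continuous_at_imp_continuous_on isCont_Phi)
  qed
  ultimately have "open (crossing \<nu> \<alpha>)" by (simp add: open_Int open_UN)
  then show ?thesis by (rule borel_open)
qed

text \<open>Of two different scales at which the curves touch without crossing, the smaller one
  would have a strict crossing.\<close>

lemma critical_scale_unique:
  assumes "1 \<le> \<nu>" "0 < \<alpha>" "\<alpha> \<le> 1 / 2"
  shows "\<exists>s0. \<forall>s. 0 < s \<and> s \<noteq> s0 \<and> s \<notin> crossing \<nu> \<alpha> \<longrightarrow> (\<forall>c. \<alpha> * Phi (- (s * c)) < 1 - F_t \<nu> c)"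
proof -
  define E where "E = {s. 0 < s \<and> s \<notin> crossing \<nu> \<alpha> \<and> (\<exists>c. 1 - F_t \<nu> c \<le> \<alpha> * Phi (- (s * c)))}"
  have "s = s'" if "s \<in> E" "s' \<in> E" for s s'
    using that crossing_of_weak_crossing[OF assms, of s s'] crossing_of_weak_crossing[OF assms, of s' s]
    unfolding E_def by (cases s s' rule: linorder_cases) auto
  then obtain s0 where "E \<subseteq> {s0}" by (cases "E = {}") (simp, metis equals0I singletonI subsetI)
  then have "\<forall>c. \<alpha> * Phi (- (s * c)) < 1 - F_t \<nu> c" if "0 < s" "s \<noteq> s0" "s \<notin> crossing \<nu> \<alpha>" for s
    using that by (auto simp: E_def not_le[symmetric])
  then show ?thesis by blast
qed

lemma conditional_FDR_tendsto:
  assumes "1 \<le> \<nu>" "0 < \<alpha>" "\<alpha> \<le> 1 / 2" "\<And>n. n0 n \<le> n"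
    "(\<lambda>n. real (n0 n) / real n) \<longlonglongrightarrow> 1" "0 < s"
  shows "s \<in> crossing \<nu> \<alpha> \<Longrightarrow> (\<lambda>n. conditional_FDR \<alpha> \<nu> n (n0 n) s) \<longlonglongrightarrow> 1"
    and "\<forall>c. \<alpha> * Phi (- (s * c)) < 1 - F_t \<nu> c \<Longrightarrow> (\<lambda>n. conditional_FDR \<alpha> \<nu> n (n0 n) s) \<longlonglongrightarrow> 0"
proof -
  interpret conditional_t_model \<nu> \<alpha> n0 s
    by unfold_locales (use assms in auto)
  have eq: "conditional_FDR \<alpha> \<nu> n (n0 n) s = (\<integral>x. FDP \<alpha> n (n0 n) (pv (n0 n) x) \<partial>PX (n0 n))" for n
    unfolding conditional_FDR_def pv_def[abs_def] G_def ..
  show "(\<lambda>n. conditional_FDR \<alpha> \<nu> n (n0 n) s) \<longlonglongrightarrow> 1" if "s \<in> crossing \<nu> \<alpha>"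
    using that inner_tendsto_1 unfolding eq crossing_def G_def by auto
  show "(\<lambda>n. conditional_FDR \<alpha> \<nu> n (n0 n) s) \<longlonglongrightarrow> 0" if "\<forall>c. \<alpha> * Phi (- (s * c)) < 1 - F_t \<nu> c"
    using that inner_tendsto_0 unfolding eq G_def by auto
qed

lemma FDR_DEXt_tendsto:
  assumes "1 \<le> \<nu>" "0 < \<alpha>" "\<alpha> \<le> 1 / 2" "\<And>n. n0 n \<le> n"
    "(\<lambda>n. real (n0 n) / real n) \<longlonglongrightarrow> 1"
  shows "(\<lambda>n. FDR_DEXt \<alpha> n (n0 n) \<nu>) \<longlonglongrightarrow> measure (PZ \<nu>) {z\<in>space (PZ \<nu>). S_stat \<nu> z \<in> crossing \<nu> \<alpha>}"
proof -
  interpret Z: prob_space "PZ \<nu>" by (rule prob_space_PZ)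
  obtain s0 where s0: "\<forall>s. 0 < s \<and> s \<noteq> s0 \<and> s \<notin> crossing \<nu> \<alpha> \<longrightarrow> (\<forall>c. \<alpha> * Phi (- (s * c)) < 1 - F_t \<nu> c)"
    using critical_scale_unique[OF assms(1-3)] by blast
  let ?C = "{z\<in>space (PZ \<nu>). S_stat \<nu> z \<in> crossing \<nu> \<alpha>}"
  note [measurable] = crossing_borel
  have C: "?C \<in> sets (PZ \<nu>)" by measurable
  have bound: "norm (conditional_FDR \<alpha> \<nu> n (n0 n) s) \<le> 1" for n s
  proof -
    interpret X: prob_space "PZ (n0 n)" by (rule prob_space_PZ)
    let ?f = "\<lambda>x. FDP \<alpha> n (n0 n) (\<lambda>i. if i < n0 n then 1 - F_t \<nu> (x i / s) else 0)"
    have "norm (conditional_FDR \<alpha> \<nu> n (n0 n) s) \<le> (\<integral>x. norm (?f x) \<partial>PZ (n0 n))"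
      unfolding conditional_FDR_def by (rule integral_norm_bound)
    also have "\<dots> \<le> (\<integral>x. 1 \<partial>PZ (n0 n))"
      by (rule integral_mono_AE') (auto simp: FDP_bounds)
    finally show ?thesis by (simp add: X.prob_space)
  qed
  have "(\<lambda>n. \<integral>z. conditional_FDR \<alpha> \<nu> n (n0 n) (S_stat \<nu> z) \<partial>PZ \<nu>) \<longlonglongrightarrow> (\<integral>z. indicator ?C z \<partial>PZ \<nu>)"
  proof (rule integral_dominated_convergence[where w = "\<lambda>_. 1"])
    show "(\<lambda>z. conditional_FDR \<alpha> \<nu> n (n0 n) (S_stat \<nu> z)) \<in> borel_measurable (PZ \<nu>)" for n
      using assms by (intro conditional_FDR_measurable)
    \<comment> \<open>The value 0 is removed because the conditional limits require a positive
      scale, and \<open>s0\<close> because neither of them applies there.\<close>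
    have ae: "AE z in PZ \<nu>. S_stat \<nu> z \<noteq> 0 \<and> S_stat \<nu> z \<noteq> s0"
      using AE_S_stat_neq[OF assms(1), of 0] AE_S_stat_neq[OF assms(1), of s0] by eventually_elim simp
    have conv: "(\<lambda>n. conditional_FDR \<alpha> \<nu> n (n0 n) (S_stat \<nu> z)) \<longlonglongrightarrow> indicator ?C z"
      if "z \<in> space (PZ \<nu>)" "S_stat \<nu> z \<noteq> 0 \<and> S_stat \<nu> z \<noteq> s0" for z
    proof -
      have "0 \<le> S_stat \<nu> z" by (simp add: S_stat_def sum_nonneg)
      then have pos: "0 < S_stat \<nu> z" using that by simp
      note lim = conditional_FDR_tendsto[OF assms(1-5) pos]
      show ?thesis
      proof (cases "S_stat \<nu> z \<in> crossing \<nu> \<alpha>")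
        case True
        then show ?thesis using lim(1)[OF True] that by simp
      next
        case False
        have "\<forall>c. \<alpha> * Phi (- (S_stat \<nu> z * c)) < 1 - F_t \<nu> c" using s0 pos that(2) False by blast
        from lim(2)[OF this] show ?thesis using False by simp
      qed
    qed
    show "AE z in PZ \<nu>. (\<lambda>n. conditional_FDR \<alpha> \<nu> n (n0 n) (S_stat \<nu> z)) \<longlonglongrightarrow> indicator ?C z"
      using AE_space ae by eventually_elim (rule conv)
  qed (use C bound in auto)
  then show ?thesis
    using C assms by (simp add: FDR_DEXt_eq)
qed

text \<open>The critical b = sqrt(-2 ln \<alpha>) is approached from both sides and never treated
  itself: each neighbouring b bounds the crossing event by a lower tail event of S, and continuity
  of Phi closes the squeeze.\<close>

lemma crossing_probability_tendsto:
  assumes "0 < \<alpha>" "\<alpha> \<le> 1 / 2"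
  shows "(\<lambda>\<nu>. measure (PZ \<nu>) {z\<in>space (PZ \<nu>). S_stat \<nu> z \<in> crossing \<nu> \<alpha>}) \<longlonglongrightarrow> Phi (- sqrt (- 2 * ln \<alpha>))"
    (is "?p \<longlonglongrightarrow> Phi (- ?a)")
proof -
  have "ln \<alpha> < 0" using assms by simp
  then have a: "0 < ?a" by simp
  note [measurable] = crossing_borel
  let ?q = "\<lambda>b \<nu>. measure (PZ \<nu>) {z\<in>space (PZ \<nu>). S_stat \<nu> z \<le> sqrt (crit_sq b (real \<nu>))}"
  have upper: "\<forall>\<^sub>F \<nu> in sequentially. ?p \<nu> \<le> ?q b \<nu>" if b: "0 < b" "b < ?a" for b
    using eventually_no_crossing[OF assms b] eventually_crit_sq_pos[OF b(1)] eventually_ge_at_top[of 1]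
  proof eventually_elim
    case (elim \<nu>)
    interpret prob_space "PZ \<nu>" by (rule prob_space_PZ)
    have "sqrt (crit_sq b (real \<nu>)) \<notin> crossing \<nu> \<alpha>" using elim(1) by (auto simp: crossing_def not_less)
    then have "S_stat \<nu> z \<le> sqrt (crit_sq b (real \<nu>))" if "S_stat \<nu> z \<in> crossing \<nu> \<alpha>" for z
      using crossing_downward[OF elim(3) assms that, of "sqrt (crit_sq b (real \<nu>))"] elim(2) by force
    then show ?case by (intro finite_measure_mono) auto
  qed
  have lower: "\<forall>\<^sub>F \<nu> in sequentially. ?q b \<nu> \<le> ?p \<nu>" if b: "?a < b" for b
    using eventually_crossing[OF assms b] eventually_crit_sq_pos[OF less_trans[OF a b]] eventually_ge_at_top[of 1]
  proof eventually_elim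
    case (elim \<nu>)
    interpret prob_space "PZ \<nu>" by (rule prob_space_PZ)
    have c: "sqrt (crit_sq b (real \<nu>)) \<in> crossing \<nu> \<alpha>" using elim by (auto simp: crossing_def)
    \<comment> \<open>The crossing set contains only positive scales, so the inclusion of events
      holds only almost everywhere.\<close>
    have "AE z in PZ \<nu>. S_stat \<nu> z \<noteq> 0" by (rule AE_S_stat_neq[OF elim(3)])
    moreover have "S_stat \<nu> z \<in> crossing \<nu> \<alpha>" if "S_stat \<nu> z \<noteq> 0" "S_stat \<nu> z \<le> sqrt (crit_sq b (real \<nu>))" for z
    proof -
      have "0 \<le> S_stat \<nu> z" by (simp add: S_stat_def sum_nonneg)
      then show ?thesis using that crossing_downward[OF elim(3) assms c, of "S_stat \<nu> z"] by simp
    qed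
    ultimately show ?case by (intro finite_measure_mono_AE) auto
  qed
  have cont: "isCont (\<lambda>b. Phi (- b)) ?a" by (intro isCont_o2[OF _ isCont_Phi]) simp
  show ?thesis
  proof (rule order_tendstoI)
    fix y assume y: "y < Phi (- ?a)"
    have "\<forall>\<^sub>F b in at ?a. y < Phi (- b)"
      using order_tendstoD(1)[OF cont[unfolded isCont_def] y] .
    then have "\<forall>\<^sub>F b in at_right ?a. y < Phi (- b)" by (rule filter_leD[OF at_le[OF subset_UNIV]])
    then have "\<forall>\<^sub>F b in at_right ?a. y < Phi (- b) \<and> ?a < b" using eventually_at_right_less by eventually_elim simp
    then obtain b where b: "y < Phi (- b)" "?a < b" using eventually_happens'[OF trivial_limit_at_right_real] by blast
    show "\<forall>\<^sub>F \<nu> in sequentially. y < ?p \<nu>"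
      using order_tendstoD(1)[OF S_stat_crit_tendsto[of b] b(1)] lower[OF b(2)] by eventually_elim simp
  next
    fix y assume y: "Phi (- ?a) < y"
    have "\<forall>\<^sub>F b in at ?a. Phi (- b) < y"
      using order_tendstoD(2)[OF cont[unfolded isCont_def] y] .
    then have "\<forall>\<^sub>F b in at_left ?a. Phi (- b) < y" by (rule filter_leD[OF at_le[OF subset_UNIV]])
    moreover have "\<forall>\<^sub>F b in at_left ?a. b \<in> {0<..<?a}" using a by (rule eventually_at_left_real)
    ultimately have "\<forall>\<^sub>F b in at_left ?a. Phi (- b) < y \<and> 0 < b \<and> b < ?a" by eventually_elim simp
    then obtain b where b: "Phi (- b) < y" "0 < b" "b < ?a" using eventually_happens'[OF trivial_limit_at_left_real] by blast
    show "\<forall>\<^sub>F \<nu> in sequentially. ?p \<nu> < y"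
      using order_tendstoD(2)[OF S_stat_crit_tendsto[of b] b(1)] upper[OF b(2,3)] by eventually_elim simp
  qed
qed

theorem theorem4p3:
  fixes \<alpha> :: real and n0 :: "nat \<Rightarrow> nat"
  assumes "0 < \<alpha>" and "\<alpha> \<le> 1/2"
    and "\<And>n. n0 n \<le> n"
    and "(\<lambda>n. real (n0 n) / real n) \<longlonglongrightarrow> 1"
  shows "\<exists>FDRinf :: nat \<Rightarrow> real.
           (\<forall>\<nu>\<ge>1. (\<lambda>n. FDR_DEXt \<alpha> n (n0 n) \<nu>) \<longlonglongrightarrow> FDRinf \<nu>)
         \<and> FDRinf \<longlonglongrightarrow> Phi (- sqrt (- 2 * ln \<alpha>))"
proof (intro exI conjI allI impI)
  \<comment> \<open>The witness for \<open>FDRinf\<close> is the probability that S falls into the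
    crossing set.\<close>
  show "(\<lambda>n. FDR_DEXt \<alpha> n (n0 n) \<nu>) \<longlonglongrightarrow> measure (PZ \<nu>) {z\<in>space (PZ \<nu>). S_stat \<nu> z \<in> crossing \<nu> \<alpha>}" if "1 \<le> \<nu>" for \<nu>
    using that by (rule FDR_DEXt_tendsto[OF _ assms])
  show "(\<lambda>\<nu>. measure (PZ \<nu>) {z\<in>space (PZ \<nu>). S_stat \<nu> z \<in> crossing \<nu> \<alpha>}) \<longlonglongrightarrow> Phi (- sqrt (- 2 * ln \<alpha>))"
    by (rule crossing_probability_tendsto[OF assms(1,2)])
qed

end
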